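(* Let $X$ be a metric space with a free $\mathbb{Z}/2$-action, and let $\delta > 0$. Let $V$ be an $n$-dimensional real vector space of continuous odd functions $f \colon X \to \mathbb{R}$, such that for every $A \subset X$ of diameter at most $\delta$ there is an $f \in V$ such that $f|_A$ is strictly positive. Then there is a continuous odd map $X_\delta \to S^{n-1}$; in particular, $\mathrm{ind}(X_\delta) \le n-1$.
   Context: A $\mathbb{Z}/2$-action on a space is a continuous involution, written $x\mapsto -x$; it is free if the involution has no fixed points. A function $f\colon X\to\mathbb{R}$ is odd if $f(-x)=-f(x)$ for all $x\in X$; more generally, a map between spaces with $\mathbb{Z}/2$-actions is odd if it commutes with the involutions. The (Vietoris--Rips) metric thickening $X_\delta$ is the set of probability measures $\mu=\sum_i\lambda_i x_i$ on $X$ (finite convex combinations of points of $X$, each identified with its Dirac measure) whose support is finite and has diameter at most $\delta$, equipped with the $1$-Wasserstein metric. The involution on $X$ is extended to $X_\delta$ by $\sum_i\lambda_i x_i\mapsto\sum_i\lambda_i(-x_i)$. The sphere $S^{n-1}$ carries the antipodal involution. For a metric space $Y$ with a free $\mathbb{Z}/2$-action, the cohomological index $\mathrm{ind}(Y)$ is the smallest integer $m$ such that $t^{m+1}$ is in the kernel of the map $H^*(\mathbb{R}P^\infty;\mathbb{F}_2)\cong\mathbb{F}_2[t]\to H^*(Y/(\mathbb{Z}/2);\mathbb{F}_2)$ induced by the odd map $Y\to S^\infty$, which is unique up to $\mathbb{Z}/2$-equivariant homotopy. *)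

theory Defs
  imports
    "HOL-Homology.Homology"
    "HOL-Probability.Probability"
    "HOL-Library.Z2"
    "HOL-Library.Function_Algebras"
begin

section \<open>Involutions, odd maps and orbit spaces\<close>

definition free_involution :: "('a::topological_space \<Rightarrow> 'a) \<Rightarrow> bool" where
  "free_involution a \<longleftrightarrow>
     continuous_on UNIV a \<and> (\<forall>x. a (a x) = x) \<and> (\<forall>x. a x \<noteq> x)"

definition odd_map ::
  "'a topology \<Rightarrow> ('a \<Rightarrow> 'a) \<Rightarrow> 'b topology \<Rightarrow> ('b \<Rightarrow> 'b) \<Rightarrow> ('a \<Rightarrow> 'b) \<Rightarrow> bool" where
  "odd_map Y a Z b h \<longleftrightarrow>
     continuous_map Y Z h \<and> (\<forall>y \<in> topspace Y. h (a y) = b (h y))"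

definition orbit :: "('a \<Rightarrow> 'a) \<Rightarrow> 'a \<Rightarrow> 'a set" where
  "orbit a y = {y, a y}"

text \<open>The set of orbits with the quotient topology.  An odd map h induces the map
  \<open>image h\<close> on orbit spaces, since the image of \<open>{y, a y}\<close> is \<open>{h y, b (h y)}\<close>.\<close>

definition orbit_space :: "'a topology \<Rightarrow> ('a \<Rightarrow> 'a) \<Rightarrow> 'a set topology" where
  "orbit_space Y a =
     topology (\<lambda>U. U \<subseteq> orbit a ` topspace Y \<and> openin Y {y \<in> topspace Y. orbit a y \<in> U})"

lemma openin_orbit_space:
  "openin (orbit_space Y a) U \<longleftrightarrow>
     U \<subseteq> orbit a ` topspace Y \<and> openin Y {y \<in> topspace Y. orbit a y \<in> U}"
proof -
  have inter: "{y \<in> topspace Y. orbit a y \<in> S \<inter> T}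
      = {y \<in> topspace Y. orbit a y \<in> S} \<inter> {y \<in> topspace Y. orbit a y \<in> T}" for S T
    by auto
  have union: "{y \<in> topspace Y. orbit a y \<in> \<Union>K}
      = \<Union> ((\<lambda>S. {y \<in> topspace Y. orbit a y \<in> S}) ` K)" for K
    by auto
  have "istopology (\<lambda>U. U \<subseteq> orbit a ` topspace Y \<and> openin Y {y \<in> topspace Y. orbit a y \<in> U})"
    unfolding istopology_def inter union
    by (auto intro!: openin_Int openin_Union simp del: Int_iff)
  then show ?thesis by (simp add: orbit_space_def topology_inverse')
qed


section \<open>Spheres and infinite real projective space\<close>

definition antipode :: "(nat \<Rightarrow> real) \<Rightarrow> nat \<Rightarrow> real" where
  "antipode x = (\<lambda>i. - x i)"

text \<open>The union of the library's (nested) spheres \<open>nsphere p\<close>, with the colimit topology.\<close>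

definition sphere_infty :: "(nat \<Rightarrow> real) topology" where
  "sphere_infty =
     topology (\<lambda>U. U \<subseteq> (\<Union>p. topspace (nsphere p)) \<and>
                   (\<forall>p. openin (nsphere p) (U \<inter> topspace (nsphere p))))"

lemma openin_sphere_infty:
  "openin sphere_infty U \<longleftrightarrow>
     U \<subseteq> (\<Union>p. topspace (nsphere p)) \<and> (\<forall>p. openin (nsphere p) (U \<inter> topspace (nsphere p)))"
proof -
  have inter: "openin Z (S \<inter> T \<inter> topspace Z)"
    if "openin Z (S \<inter> topspace Z)" "openin Z (T \<inter> topspace Z)" for S T and Z :: "(nat \<Rightarrow> real) topology"
    using openin_Int [OF that] by (simp add: Int_ac)
  have union: "openin Z (\<Union>K \<inter> topspace Z)"
    if "\<And>S. S \<in> K \<Longrightarrow> openin Z (S \<inter> topspace Z)" for K and Z :: "(nat \<Rightarrow> real) topology"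
    unfolding Int_Union2 by (rule openin_Union) (use that in auto)
  have "istopology (\<lambda>U. U \<subseteq> (\<Union>p. topspace (nsphere p)) \<and>
          (\<forall>p. openin (nsphere p) (U \<inter> topspace (nsphere p))))"
    unfolding istopology_def
    by (intro conjI allI impI inter union) (simp_all add: le_infI1 Sup_le_iff)
  then show ?thesis by (simp add: sphere_infty_def topology_inverse')
qed

definition RP_infty :: "(nat \<Rightarrow> real) set topology" where
  "RP_infty = orbit_space sphere_infty antipode"


section \<open>Singular cohomology with coefficients in the field with two elements\<close>

text \<open>A p-cochain is a \<open>bit\<close>-valued function on singular p-simplices, extended by 0 to all other
  functions.  No signs occur in the coboundary because the coefficients have characteristic 2.\<close>

type_synonym 'a cochain = "((nat \<Rightarrow> real) \<Rightarrow> 'a) \<Rightarrow> bit"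

definition on_simplices :: "nat \<Rightarrow> 'a topology \<Rightarrow> 'a cochain \<Rightarrow> 'a cochain" where
  "on_simplices p X \<phi> = (\<lambda>\<sigma>. if singular_simplex p X \<sigma> then \<phi> \<sigma> else 0)"

definition cochain_set :: "nat \<Rightarrow> 'a topology \<Rightarrow> 'a cochain set" where
  "cochain_set p X = {\<phi>. \<forall>\<sigma>. \<not> singular_simplex p X \<sigma> \<longrightarrow> \<phi> \<sigma> = 0}"

definition coboundary :: "nat \<Rightarrow> 'a topology \<Rightarrow> 'a cochain \<Rightarrow> 'a cochain" where
  "coboundary p X \<phi> =
     on_simplices (Suc p) X (\<lambda>\<sigma>. \<Sum>k\<le>Suc p. \<phi> (singular_face (Suc p) k \<sigma>))"

definition cocycle_set :: "nat \<Rightarrow> 'a topology \<Rightarrow> 'a cochain set" where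
  "cocycle_set p X = {\<phi> \<in> cochain_set p X. coboundary p X \<phi> = (\<lambda>\<sigma>. 0)}"

definition coboundary_set :: "nat \<Rightarrow> 'a topology \<Rightarrow> 'a cochain set" where
  "coboundary_set p X =
     (case p of 0 \<Rightarrow> {\<lambda>\<sigma>. 0} | Suc q \<Rightarrow> coboundary q X ` cochain_set q X)"

definition cocycle_group :: "nat \<Rightarrow> 'a topology \<Rightarrow> 'a cochain monoid" where
  "cocycle_group p X =
     \<lparr>carrier = cocycle_set p X, monoid.mult = (\<lambda>\<phi> \<psi> \<sigma>. \<phi> \<sigma> + \<psi> \<sigma>), one = (\<lambda>\<sigma>. 0)\<rparr>"

text \<open>Cohomology groups are written multiplicatively, as homology groups are in the library:
  \<open>\<one>\<close> of \<open>cohomology_group p X\<close> is the zero class.\<close>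

definition cohomology_group :: "nat \<Rightarrow> 'a topology \<Rightarrow> 'a cochain set monoid" where
  "cohomology_group p X = cocycle_group p X Mod coboundary_set p X"

definition cohomology_class :: "nat \<Rightarrow> 'a topology \<Rightarrow> 'a cochain \<Rightarrow> 'a cochain set" where
  "cohomology_class p X z = coboundary_set p X #>\<^bsub>cocycle_group p X\<^esub> z"

definition front_face :: "nat \<Rightarrow> ((nat \<Rightarrow> real) \<Rightarrow> 'a) \<Rightarrow> (nat \<Rightarrow> real) \<Rightarrow> 'a" where
  "front_face p \<sigma> = restrict \<sigma> (standard_simplex p)"

definition back_face :: "nat \<Rightarrow> nat \<Rightarrow> ((nat \<Rightarrow> real) \<Rightarrow> 'a) \<Rightarrow> (nat \<Rightarrow> real) \<Rightarrow> 'a" where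
  "back_face p q \<sigma> =
     restrict (\<lambda>x. \<sigma> (\<lambda>i. if i < p then 0 else x (i - p))) (standard_simplex q)"

definition cup_cochain ::
  "nat \<Rightarrow> nat \<Rightarrow> 'a topology \<Rightarrow> 'a cochain \<Rightarrow> 'a cochain \<Rightarrow> 'a cochain" where
  "cup_cochain p q X \<phi> \<psi> =
     on_simplices (p + q) X (\<lambda>\<sigma>. \<phi> (front_face p \<sigma>) * \<psi> (back_face p q \<sigma>))"

text \<open>The operations below take classes as sets of representing cocycles; as the class of the
  result does not depend on the representatives, each union is a union of equal classes.\<close>

definition cup ::
  "nat \<Rightarrow> nat \<Rightarrow> 'a topology \<Rightarrow> 'a cochain set \<Rightarrow> 'a cochain set \<Rightarrow> 'a cochain set" where
  "cup p q X A B = (\<Union>\<phi>\<in>A. \<Union>\<psi>\<in>B. cohomology_class (p + q) X (cup_cochain p q X \<phi> \<psi>))"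

definition unit_class :: "'a topology \<Rightarrow> 'a cochain set" where
  "unit_class X = cohomology_class 0 X (on_simplices 0 X (\<lambda>\<sigma>. 1))"

primrec cup_power :: "'a topology \<Rightarrow> 'a cochain set \<Rightarrow> nat \<Rightarrow> 'a cochain set" where
  "cup_power X t 0 = unit_class X"
| "cup_power X t (Suc k) = cup k 1 X (cup_power X t k) t"

definition cohomology_induced ::
  "nat \<Rightarrow> 'a topology \<Rightarrow> ('a \<Rightarrow> 'b) \<Rightarrow> 'b cochain set \<Rightarrow> 'a cochain set" where
  "cohomology_induced p X g A =
     (\<Union>\<phi>\<in>A. cohomology_class p X (on_simplices p X (\<lambda>\<sigma>. \<phi> (simplex_map p g \<sigma>))))"


section \<open>The cohomological index\<close>

text \<open>The nonzero element t of the first cohomology group of \<open>RP_infty\<close> is unique, and so is, up to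
  equivariant homotopy, the odd map h into the infinite sphere; hence the quantifiers over t and h
  only serve to name these objects.  The number k is m + 1 for the integer m \<open>\<ge>\<close> -1 of the usual
  definition (thus the empty space has index -1), and the infimum, which is a minimum whenever some
  such m exists, is \<open>\<infinity>\<close> otherwise.\<close>

definition cohomological_index :: "'a topology \<Rightarrow> ('a \<Rightarrow> 'a) \<Rightarrow> ereal" where
  "cohomological_index Y a =
     Inf {ereal (real k - 1) | k.
            \<exists>h. odd_map Y a sphere_infty antipode h \<and>
                (\<forall>t \<in> carrier (cohomology_group 1 RP_infty). t \<noteq> \<one>\<^bsub>cohomology_group 1 RP_infty\<^esub> \<longrightarrow>
                   cohomology_induced k (orbit_space Y a) (image h) (cup_power RP_infty t k)
                     = \<one>\<^bsub>cohomology_group k (orbit_space Y a)\<^esub>)}"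


section \<open>The Vietoris--Rips metric thickening\<close>

definition VR_thickening :: "real \<Rightarrow> 'a::metric_space pmf set" where
  "VR_thickening \<delta> = {\<mu>. finite (set_pmf \<mu>) \<and> diameter (set_pmf \<mu>) \<le> \<delta>}"

text \<open>For unbounded sets \<open>diameter\<close> is unspecified; the supports here are finite, but for arbitrary
  sets a diameter bound must be stated together with boundedness.  An involution a of the space acts
  on measures by \<open>map_pmf a\<close>.  If a is not isometric, this need not map \<open>VR_thickening \<delta>\<close> into
  itself; \<open>odd_map\<close> and \<open>orbit_space\<close> then still make sense, the latter identifying two measures of
  the thickening iff they are equal or exchanged by \<open>map_pmf a\<close>.\<close>

definition wasserstein1 :: "'a::metric_space pmf \<Rightarrow> 'a pmf \<Rightarrow> real" where
  "wasserstein1 \<mu> \<nu> =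
     Inf {measure_pmf.expectation \<gamma> (\<lambda>(x, y). dist x y) | \<gamma>.
            map_pmf fst \<gamma> = \<mu> \<and> map_pmf snd \<gamma> = \<nu>}"

definition VR_topology :: "real \<Rightarrow> 'a::metric_space pmf topology" where
  "VR_topology \<delta> = Metric_space.mtopology (VR_thickening \<delta>) wasserstein1"


section \<open>Finite-dimensional spaces of real functions\<close>

interpretation funspace: vector_space "\<lambda>(c::real) (f::'a \<Rightarrow> real) x. c * f x"
  by (rule vector_space.intro) (simp_all add: fun_eq_iff distrib_left distrib_right)

definition function_space_of_dim :: "('a \<Rightarrow> real) set \<Rightarrow> nat \<Rightarrow> bool" where
  "function_space_of_dim V n \<longleftrightarrow>
     funspace.subspace V \<and>
     (\<exists>B. finite B \<and> card B = n \<and> funspace.independent B \<and> funspace.span B = V)"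

end

theory Submission
  imports Defs
begin

text \<open>In its usual form the Lusternik-Schnirelmann bound multiplies relative classes of the
  pairs \<open>(X, U i)\<close>. Here the product is formed with cochains: the front and back faces
  of a simplex inside \<open>U i\<close> again lie inside \<open>U i\<close>, so a product vanishes
  on such simplices as soon as one of its factors does. It then remains to see that a cocycle
  vanishing on all simplices inside members of an open cover is a coboundary. Its primitive comes
  from subdivision, which acts on integral chains, so cochains with values in \<open>bit\<close> are
  evaluated on integral chains modulo 2. Classes are sets of cochains and the operations on them are
  unions, so the product argument has to hold for every representative; each change of
  representative costs a coboundary, which is carried along in the induction. For the map
  \<open>g\<close>, the hypothesis on \<open>V\<close> enters twice: for single points it says that
  the basis has no common zero, so that normalizing is possible, and for supports it supplies the
  linear form.\<close>

text \<open>Let \<open>b\<close> be a basis of \<open>V\<close>.  Integrating the normalized functions \<open>b i / \<bar>b\<bar>\<close> against a measure of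
  the thickening gives a vector of \<open>\<real>\<^sup>n\<close>, which is nonzero because some linear form (the one given by a
  function positive on the support) is positive on it; normalizing this vector gives the odd map \<open>g\<close>.

  For the index, the orbit space is covered by the \<open>n\<close> open sets where the coordinates of \<open>g\<close> do not
  vanish.  On each of them the map to \<open>RP_infty\<close> factors through a contractible hemisphere, so the
  pullback of \<open>t\<close> is trivial there.  By the Lusternik--Schnirelmann argument, the pullback of \<open>t^n\<close> is
  represented by a cocycle that vanishes on all simplices lying in one of the sets, hence it is zero.\<close>

section \<open>Cochains and small simplices\<close>

text \<open>By default the simplifier turns \<open>+\<close> and \<open>*\<close> on \<open>bit\<close> into bit operations.\<close>

declare add_bit_eq_xor [simp del] mult_bit_eq_and [simp del]

lemma bit_add_self [simp]: "(a::bit) + a = 0"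
  by (cases a) (auto simp: add_bit_eq_xor)

lemma bit_add_eq_0_iff [simp]: "(a::bit) + b = 0 \<longleftrightarrow> a = b"
  by (cases a; cases b) (auto simp: add_bit_eq_xor)

text \<open>The mod 2 pairing with integral chains: \<open>of_int\<close> reduces the coefficients.
  Integral chains are kept because boundary, subdivision and its chain homotopy are defined on
  them.\<close>

definition eval_chain :: "'a cochain \<Rightarrow> 'a chain \<Rightarrow> bit" where
  "eval_chain \<phi> c = (\<Sum>\<sigma>\<in>Poly_Mapping.keys c. of_int (Poly_Mapping.lookup c \<sigma>) * \<phi> \<sigma>)"

lemma eval_chain_superset:
  assumes "finite S" "Poly_Mapping.keys c \<subseteq> S"
  shows "eval_chain \<phi> c = (\<Sum>\<sigma>\<in>S. of_int (Poly_Mapping.lookup c \<sigma>) * \<phi> \<sigma>)"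
  unfolding eval_chain_def using assms
  by (intro sum.mono_neutral_left) (auto simp: in_keys_iff)

lemma eval_chain_0 [simp]: "eval_chain \<phi> 0 = 0"
  by (simp add: eval_chain_def)

lemma eval_chain_of [simp]: "eval_chain \<phi> (frag_of \<sigma>) = \<phi> \<sigma>"
  by (simp add: eval_chain_def)

lemma eval_chain_cmul [simp]: "eval_chain \<phi> (frag_cmul k c) = of_int k * eval_chain \<phi> c"
  by (subst eval_chain_superset [of "Poly_Mapping.keys c"])
     (auto simp: keys_cmul eval_chain_def sum_distrib_left mult.assoc)

lemma eval_chain_add: "eval_chain \<phi> (a + b) = eval_chain \<phi> a + eval_chain \<phi> b"
proof -
  let ?S = "Poly_Mapping.keys a \<union> Poly_Mapping.keys b"
  have "eval_chain \<phi> (a + b) = (\<Sum>\<sigma>\<in>?S. of_int (Poly_Mapping.lookup (a + b) \<sigma>) * \<phi> \<sigma>)"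
    using keys_add [of a b] by (intro eval_chain_superset) auto
  moreover have "eval_chain \<phi> a = (\<Sum>\<sigma>\<in>?S. of_int (Poly_Mapping.lookup a \<sigma>) * \<phi> \<sigma>)"
    "eval_chain \<phi> b = (\<Sum>\<sigma>\<in>?S. of_int (Poly_Mapping.lookup b \<sigma>) * \<phi> \<sigma>)"
    by (auto intro: eval_chain_superset)
  ultimately show ?thesis
    by (simp add: lookup_add distrib_right sum.distrib)
qed

text \<open>Signs disappear in characteristic 2. The form with a difference is what the induction
  step of \<open>frag_induction\<close> asks for.\<close>

lemma eval_chain_diff: "eval_chain \<phi> (a - b) = eval_chain \<phi> a + eval_chain \<phi> b"
proof -
  have "eval_chain \<phi> a = eval_chain \<phi> (a - b) + eval_chain \<phi> b"
    by (simp flip: eval_chain_add)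
  then show ?thesis by (simp add: add.assoc)
qed

lemma eval_chain_sum: "eval_chain \<phi> (sum f I) = (\<Sum>i\<in>I. eval_chain \<phi> (f i))"
  by (induction I rule: infinite_finite_induct) (auto simp: eval_chain_add)

text \<open>Both sides are additive in \<open>c\<close>, and on a single simplex the signs of the
  boundary reduce to 1.\<close>

lemma eval_chain_coboundary:
  assumes "singular_chain (Suc p) X c"
  shows "eval_chain (coboundary p X \<phi>) c = eval_chain \<phi> (chain_boundary (Suc p) c)"
  using assms unfolding singular_chain_def
proof (induction c rule: frag_induction)
  case (one \<sigma>)
  then show ?case
    by (simp add: chain_boundary_of eval_chain_sum coboundary_def on_simplices_def
        eval_chain_diff eval_chain_add del: sum.atMost_Suc)
next
  case (diff a b)
  then show ?case by (simp add: eval_chain_diff chain_boundary_diff)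
qed simp

lemma eval_chain_cocycle_boundary:
  assumes "z \<in> cocycle_set p X" "singular_chain (Suc p) X c"
  shows "eval_chain z (chain_boundary (Suc p) c) = 0"
proof -
  have "eval_chain z (chain_boundary (Suc p) c) = eval_chain (coboundary p X z) c"
    using assms(2) by (simp add: eval_chain_coboundary)
  also have "\<dots> = 0" using assms(1) by (simp add: cocycle_set_def eval_chain_def)
  finally show ?thesis .
qed

section \<open>Iterated subdivision and cocycles vanishing on small simplices\<close>

lemma iterated_subdivision_chain:
  "singular_chain p X c \<Longrightarrow> singular_chain p X ((singular_subdivision p ^^ n) c)"
  by (induction n) (auto intro: singular_chain_singular_subdivision)

lemma chain_boundary_iterated_subdivision:
  "singular_chain p X c \<Longrightarrow> chain_boundary p ((singular_subdivision p ^^ n) c) =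
     (singular_subdivision (p - Suc 0) ^^ n) (chain_boundary p c)"
  by (induction n)
     (auto simp: chain_boundary_singular_subdivision [OF iterated_subdivision_chain])

text \<open>If \<open>h\<close> is the chain homotopy between the identity and the subdivision \<open>sd\<close>, then
  \<open>w \<tau> = (\<Sum>i. z (h (sd^i \<tau>)))\<close> satisfies \<open>\<delta>w = z\<close> by telescoping.  The sum is finite since \<open>sd^i \<tau>\<close>,
  and by naturality \<open>h (sd^i \<tau>)\<close>, is small for large \<open>i\<close>.\<close>

lemma cocycle_vanishing_on_small_simplices:
  fixes X :: "'a topology"
  assumes opn: "\<And>U. U \<in> \<C> \<Longrightarrow> openin X U" and cover: "topspace X \<subseteq> \<Union>\<C>"
    and z: "z \<in> cocycle_set (Suc p) X"
    and small: "\<And>\<sigma> U. \<lbrakk>U \<in> \<C>; singular_simplex (Suc p) (subtopology X U) \<sigma>\<rbrakk> \<Longrightarrow> z \<sigma> = 0"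
  shows "z \<in> coboundary_set (Suc p) X"
proof -
  obtain h :: "nat \<Rightarrow> 'a chain \<Rightarrow> 'a chain" where h:
    "\<And>p. h p 0 = 0" "\<And>p c1 c2. h p (c1 - c2) = h p c1 - h p c2"
    "\<And>p X c. singular_chain p X c \<Longrightarrow> singular_chain (Suc p) X (h p c)"
    "\<And>p X c. singular_chain p X c \<Longrightarrow>
       chain_boundary (Suc p) (h p c) + h (p - Suc 0) (chain_boundary p c) = singular_subdivision p c - c"
    using chain_homotopic_singular_subdivision by blast
  \<comment> \<open>The partial sums are kept as functions of \<open>m\<close>, because the number
    of subdivisions that makes a chain small depends on the chain.\<close>
  define E where "E m c = (\<Sum>i<m. eval_chain z (h p ((singular_subdivision p ^^ i) c)))" for m c
  have E_diff: "E m (a - b) = E m a + E m b" for m a b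
    by (simp add: E_def singular_subdivision_power_diff h eval_chain_diff sum.distrib)
  have eval_small: "eval_chain z c = 0"
    if "U \<in> \<C>" "singular_chain (Suc p) (subtopology X U) c" for U c
    unfolding eval_chain_def
  proof (intro sum.neutral ballI)
    fix f assume "f \<in> Poly_Mapping.keys c"
    then have "z f = 0" using that by (intro small [of U]) (auto simp: singular_chain_def)
    then show "of_int (Poly_Mapping.lookup c f) * z f = 0" by simp
  qed
  \<comment> \<open>The properties of \<open>h\<close> hold for every topology, in particular for
    \<open>subtopology X V\<close>; hence \<open>h\<close> maps chains inside \<open>V\<close> to
    chains inside \<open>V\<close>. Different simplices of \<open>c\<close> may need different
    \<open>V\<close>, so the argument goes through single simplices.\<close>
  have h_small: "eval_chain z (h p c) = 0"
    if c: "singular_chain p X c" and sm: "\<And>f. f \<in> Poly_Mapping.keys c \<Longrightarrow> \<exists>V\<in>\<C>. f \<in> standard_simplex p \<rightarrow> V" for c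
  proof -
    have "Poly_Mapping.keys c \<subseteq> {f. \<exists>V\<in>\<C>. singular_simplex p (subtopology X V) f}"
    proof
      fix f assume f: "f \<in> Poly_Mapping.keys c"
      then obtain V where "V \<in> \<C>" "f ` standard_simplex p \<subseteq> V"
        using sm [OF f] by (auto simp: image_subset_iff_funcset)
      with f show "f \<in> {f. \<exists>V\<in>\<C>. singular_simplex p (subtopology X V) f}"
        using c by (auto simp: singular_chain_def singular_simplex_subtopology)
    qed
    then show ?thesis
    proof (induction c rule: frag_induction)
      case (one f)
      then obtain V where "V \<in> \<C>" "singular_chain p (subtopology X V) (frag_of f)"
        by (auto simp: singular_chain_of)
      then show ?case by (intro eval_small [of V] h)
    qed (auto simp: h eval_chain_diff)
  qed
  have stable: "\<exists>N. \<forall>m\<ge>N. E m c = E N c" if c: "singular_chain p X c" for c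
  proof -
    obtain N where N: "\<And>m f. \<lbrakk>N \<le> m; f \<in> Poly_Mapping.keys ((singular_subdivision p ^^ m) c)\<rbrakk>
        \<Longrightarrow> \<exists>V\<in>\<C>. f \<in> standard_simplex p \<rightarrow> V"
      using sufficient_iterated_singular_subdivision_exists [OF opn cover c] by blast
    have "E m c = E N c" if "m \<ge> N" for m
      unfolding E_def
    proof (rule sum.mono_neutral_right)
      show "\<forall>i\<in>{..<m} - {..<N}. eval_chain z (h p ((singular_subdivision p ^^ i) c)) = 0"
      proof
        fix i assume i: "i \<in> {..<m} - {..<N}"
        show "eval_chain z (h p ((singular_subdivision p ^^ i) c)) = 0"
          by (rule h_small [OF iterated_subdivision_chain [OF c]]) (use i N [of i] in auto)
      qed
    qed (use that in auto)
    then show ?thesis by blast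
  qed
  define N where "N c = (SOME N. \<forall>m\<ge>N. E m c = E N c)" for c
  have N: "E m c = E (N c) c" if "singular_chain p X c" "m \<ge> N c" for m c
    using someI_ex [OF stable [OF that(1)]] that unfolding N_def by blast
  define w where "w = on_simplices p X (\<lambda>\<tau>. E (N (frag_of \<tau>)) (frag_of \<tau>))"
  \<comment> \<open>\<open>w\<close> is cut off at a different index for each simplex, so on a chain
    it agrees with \<open>E m\<close> only from a common bound on.\<close>
  have w: "\<exists>M. \<forall>m\<ge>M. eval_chain w c = E m c" if "singular_chain p X c" for c
    using that unfolding singular_chain_def
  proof (induction c rule: frag_induction)
    case zero
    then show ?case by (auto simp: E_def h)
  next
    case (one \<tau>)
    then have "singular_chain p X (frag_of \<tau>)" by (simp add: singular_chain_of)
    then have "E m (frag_of \<tau>) = eval_chain w (frag_of \<tau>)" if "m \<ge> N (frag_of \<tau>)" for m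
      using N [OF _ that] one by (simp add: w_def on_simplices_def)
    then show ?case by metis
  next
    case (diff a b)
    then obtain M M' where "\<forall>m\<ge>M. eval_chain w a = E m a" "\<forall>m\<ge>M'. eval_chain w b = E m b"
      by blast
    then show ?case
      by (intro exI [of _ "max M M'"]) (auto simp: eval_chain_diff E_diff)
  qed
  have "coboundary p X w \<sigma> = z \<sigma>" if \<sigma>: "singular_simplex (Suc p) X \<sigma>" for \<sigma>
  proof -
    let ?sd = "\<lambda>i. (singular_subdivision (Suc p) ^^ i) (frag_of \<sigma>)"
    have c: "singular_chain (Suc p) X (frag_of \<sigma>)" using \<sigma> by (simp add: singular_chain_of)
    have sd: "singular_chain (Suc p) X (?sd i)" for i
      by (rule iterated_subdivision_chain [OF c])
    obtain M where M: "\<And>m. m \<ge> M \<Longrightarrow> eval_chain w (chain_boundary (Suc p) (frag_of \<sigma>)) =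
        E m (chain_boundary (Suc p) (frag_of \<sigma>))"
      using w singular_chain_boundary_alt [OF c] by meson
    obtain M' where M': "\<And>m f. \<lbrakk>M' \<le> m; f \<in> Poly_Mapping.keys (?sd m)\<rbrakk>
        \<Longrightarrow> \<exists>V\<in>\<C>. f \<in> standard_simplex (Suc p) \<rightarrow> V"
      using sufficient_iterated_singular_subdivision_exists [OF opn cover c] by blast
    define m where "m = max M M'"
    \<comment> \<open>The homotopy identity for the i-th subdivision; its boundary term is killed by
      the cocycle \<open>z\<close>.\<close>
    have step: "eval_chain z (h p ((singular_subdivision p ^^ i) (chain_boundary (Suc p) (frag_of \<sigma>))))
        = eval_chain z (?sd (Suc i)) + eval_chain z (?sd i)" for i
    proof -
      have "(singular_subdivision p ^^ i) (chain_boundary (Suc p) (frag_of \<sigma>)) = chain_boundary (Suc p) (?sd i)"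
        using chain_boundary_iterated_subdivision [OF c] by simp
      then have "chain_boundary (Suc (Suc p)) (h (Suc p) (?sd i)) +
          h p ((singular_subdivision p ^^ i) (chain_boundary (Suc p) (frag_of \<sigma>))) = ?sd (Suc i) - ?sd i"
        using h(4) [OF sd [of i]] by simp
      then have "eval_chain z (chain_boundary (Suc (Suc p)) (h (Suc p) (?sd i))) +
          eval_chain z (h p ((singular_subdivision p ^^ i) (chain_boundary (Suc p) (frag_of \<sigma>))))
          = eval_chain z (?sd (Suc i)) + eval_chain z (?sd i)"
        by (metis eval_chain_add eval_chain_diff)
      then show ?thesis
        using eval_chain_cocycle_boundary [OF z h(3) [OF sd [of i]]] by simp
    qed
    \<comment> \<open>Each inner term of the telescoping sum occurs twice and cancels modulo 2. Of
      the two ends, \<open>?sd m\<close> is small and \<open>?sd 0\<close> is the simplex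
      itself.\<close>
    have "E m (chain_boundary (Suc p) (frag_of \<sigma>)) = eval_chain z (?sd m) + eval_chain z (?sd 0)"
      unfolding E_def step by (induction m) (auto simp: ac_simps)
    moreover have "eval_chain z (?sd m) = 0"
      unfolding eval_chain_def
    proof (intro sum.neutral ballI)
      fix f assume f: "f \<in> Poly_Mapping.keys (?sd m)"
      then obtain V where V: "V \<in> \<C>" "f \<in> standard_simplex (Suc p) \<rightarrow> V"
        using M' [of m] by (auto simp: m_def)
      have "singular_simplex (Suc p) X f" using f sd [of m] by (auto simp: singular_chain_def)
      with V have "z f = 0" by (intro small [of V]) (auto simp: singular_simplex_subtopology)
      then show "of_int (Poly_Mapping.lookup (?sd m) f) * z f = 0" by simp
    qed
    ultimately have "eval_chain w (chain_boundary (Suc p) (frag_of \<sigma>)) = z \<sigma>"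
      using M [of m] by (simp add: m_def)
    then show ?thesis
      using eval_chain_coboundary [OF c, of w] by simp
  qed
  moreover have "z \<sigma> = 0" "coboundary p X w \<sigma> = 0" if "\<not> singular_simplex (Suc p) X \<sigma>" for \<sigma>
    using z that by (auto simp: cocycle_set_def cochain_set_def coboundary_def on_simplices_def)
  ultimately have "z = coboundary p X w"
    by (metis ext)
  moreover have "w \<in> cochain_set p X" by (simp add: w_def cochain_set_def on_simplices_def)
  ultimately show ?thesis by (auto simp: coboundary_set_def)
qed

section \<open>Cup products and pullbacks\<close>

lemma restrict_eqI: "(\<And>x. x \<in> A \<Longrightarrow> f x = g x) \<Longrightarrow> restrict f A = restrict g A"
  by (auto simp: restrict_def)

lemma singular_face_Suc:
  "singular_face (Suc p) k \<sigma> = restrict (\<sigma> \<circ> simplical_face k) (standard_simplex p)"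
  by (simp add: singular_face_def)

lemma front_face_simplex:
  assumes "singular_simplex n X \<sigma>" "p \<le> n"
  shows "singular_simplex p X (front_face p \<sigma>)"
proof -
  have "continuous_map (subtopology (powertop_real UNIV) (standard_simplex p)) X \<sigma>"
    using assms standard_simplex_mono [of p n] continuous_map_from_subtopology_mono
    by (metis singular_simplex_def)
  then show ?thesis
    by (auto simp: singular_simplex_def front_face_def intro: continuous_map_eq)
qed

text \<open>The affine embedding of the q-simplex onto the last \<open>q + 1\<close> vertices of the
  (p+q)-simplex. It turns back faces into precompositions, on a par with
  \<open>simplical_face\<close>.\<close>

definition shift_simplex :: "nat \<Rightarrow> (nat \<Rightarrow> real) \<Rightarrow> nat \<Rightarrow> real" where
  "shift_simplex p x = (\<lambda>i. if i < p then 0 else x (i - p))"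

lemma back_face_shift: "back_face p q \<sigma> = restrict (\<sigma> \<circ> shift_simplex p) (standard_simplex q)"
  by (simp add: back_face_def shift_simplex_def comp_def)

lemma shift_simplex_in_standard_simplex:
  assumes "x \<in> standard_simplex q"
  shows "shift_simplex p x \<in> standard_simplex (p + q)"
proof -
  have "(\<Sum>i\<le>p + q. shift_simplex p x i) = (\<Sum>i\<in>{p..p + q}. x (i - p))"
    by (rule sum.mono_neutral_cong_right) (auto simp: shift_simplex_def)
  also have "\<dots> = (\<Sum>i\<le>q. x i)"
    by (rule sum.reindex_bij_witness [of _ "\<lambda>i. i + p" "\<lambda>i. i - p"]) auto
  finally show ?thesis
    using assms by (auto simp: standard_simplex_def shift_simplex_def)
qed

lemma continuous_map_shift_simplex:
  "continuous_map (subtopology (powertop_real UNIV) (standard_simplex q))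
     (subtopology (powertop_real UNIV) (standard_simplex (p + q))) (shift_simplex p)"
proof -
  have "continuous_map (subtopology (powertop_real UNIV) (standard_simplex q)) euclideanreal
      (\<lambda>x. shift_simplex p x i)" for i
    by (cases "i < p")
       (auto simp: shift_simplex_def intro: continuous_map_from_subtopology continuous_map_product_projection)
  then show ?thesis
    by (auto simp: continuous_map_in_subtopology continuous_map_componentwise_UNIV
        shift_simplex_in_standard_simplex)
qed

lemma back_face_simplex:
  assumes "singular_simplex (p + q) X \<sigma>"
  shows "singular_simplex q X (back_face p q \<sigma>)"
proof -
  have "continuous_map (subtopology (powertop_real UNIV) (standard_simplex q)) X (\<sigma> \<circ> shift_simplex p)"
    using assms continuous_map_compose [OF continuous_map_shift_simplex]
    by (auto simp: singular_simplex_def)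
  then show ?thesis
    by (auto simp: singular_simplex_def back_face_shift intro: continuous_map_eq)
qed

lemma simplical_face_standard:
  "\<lbrakk>x \<in> standard_simplex n; k \<le> Suc n\<rbrakk> \<Longrightarrow> simplical_face k x \<in> standard_simplex (Suc n)"
  using simplical_face_in_standard_simplex [of "Suc n" k x] by simp

lemma front_face_singular_face:
  assumes "k \<le> Suc p"
  shows "front_face p (singular_face (Suc (p + q)) k \<sigma>) = singular_face (Suc p) k (front_face (Suc p) \<sigma>)"
  unfolding front_face_def singular_face_Suc
  using assms standard_simplex_mono [of p "p + q"]
  by (intro restrict_eqI) (auto simp: simplical_face_standard)

text \<open>Standard simplices are nested, and inserting a zero behind the last coordinate changes
  nothing. This identifies one of the two terms that cancel in the Leibniz rule.\<close>

lemma singular_face_front_face: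
  "singular_face (Suc p) (Suc p) (front_face (Suc p) \<sigma>) = front_face p \<sigma>"
proof -
  have "simplical_face (Suc p) x = x" if "x \<in> standard_simplex p" for x
    using that by (auto simp: simplical_face_def standard_simplex_def fun_eq_iff)
  then show ?thesis
    unfolding front_face_def singular_face_Suc using standard_simplex_mono [of p "Suc p"]
    by (intro restrict_eqI) auto
qed

lemma front_face_singular_face':
  assumes "p < k"
  shows "front_face p (singular_face (Suc (p + q)) k \<sigma>) = front_face p \<sigma>"
proof -
  have "simplical_face k x = x" if "x \<in> standard_simplex p" for x
    using that assms by (auto simp: simplical_face_def standard_simplex_def fun_eq_iff)
  then show ?thesis
    unfolding front_face_def singular_face_Suc using standard_simplex_mono [of p "p + q"]
    by (intro restrict_eqI) auto
qed

lemma back_face_singular_face: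
  assumes "k \<le> p"
  shows "back_face p q (singular_face (Suc (p + q)) k \<sigma>) = back_face (Suc p) q \<sigma>"
proof -
  have "simplical_face k (shift_simplex p x) = shift_simplex (Suc p) x" for x
    using assms by (auto simp: simplical_face_def shift_simplex_def fun_eq_iff)
  then show ?thesis
    unfolding back_face_shift singular_face_Suc
    by (intro restrict_eqI) (auto simp: shift_simplex_in_standard_simplex)
qed

lemma back_face_singular_face':
  assumes "j \<le> Suc q"
  shows "back_face p q (singular_face (Suc (p + q)) (p + j) \<sigma>) = singular_face (Suc q) j (back_face p (Suc q) \<sigma>)"
proof -
  have "simplical_face (p + j) (shift_simplex p x) = shift_simplex p (simplical_face j x)" for x :: "nat \<Rightarrow> real"
    using assms by (auto simp: simplical_face_def shift_simplex_def fun_eq_iff)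
  then show ?thesis
    unfolding back_face_shift singular_face_Suc using assms
    by (intro restrict_eqI) (auto simp: shift_simplex_in_standard_simplex simplical_face_standard)
qed

text \<open>The Leibniz rule: faces up to \<open>p\<close> affect only the front factor, later faces
  only the back factor.\<close>

lemma coboundary_cup:
  "coboundary (p + q) X (cup_cochain p q X \<phi> \<psi>) =
     (\<lambda>\<sigma>. cup_cochain (Suc p) q X (coboundary p X \<phi>) \<psi> \<sigma> + cup_cochain p (Suc q) X \<phi> (coboundary q X \<psi>) \<sigma>)"
proof
  fix \<sigma> :: "(nat \<Rightarrow> real) \<Rightarrow> 'a"
  show "coboundary (p + q) X (cup_cochain p q X \<phi> \<psi>) \<sigma> =
     cup_cochain (Suc p) q X (coboundary p X \<phi>) \<psi> \<sigma> + cup_cochain p (Suc q) X \<phi> (coboundary q X \<psi>) \<sigma>"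
  proof (cases "singular_simplex (Suc (p + q)) X \<sigma>")
    case \<sigma>: True
    let ?F = "front_face (Suc p) \<sigma>" and ?B = "back_face p (Suc q) \<sigma>"
    let ?a = "\<lambda>k. \<phi> (singular_face (Suc p) k ?F) * \<psi> (back_face (Suc p) q \<sigma>)"
    let ?b = "\<lambda>j. \<phi> (front_face p \<sigma>) * \<psi> (singular_face (Suc q) j ?B)"
    let ?c = "\<lambda>k. \<phi> (front_face p (singular_face (Suc (p + q)) k \<sigma>)) *
        \<psi> (back_face p q (singular_face (Suc (p + q)) k \<sigma>))"
    have F: "singular_simplex (Suc p) X ?F" by (rule front_face_simplex [OF \<sigma>]) simp
    have B: "singular_simplex (Suc q) X ?B" using back_face_simplex [of p "Suc q"] \<sigma> by simp
    have "coboundary (p + q) X (cup_cochain p q X \<phi> \<psi>) \<sigma> = (\<Sum>k\<le>Suc (p + q). ?c k)"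
      using \<sigma> singular_simplex_singular_face [OF \<sigma>]
      by (simp add: coboundary_def on_simplices_def cup_cochain_def del: sum.atMost_Suc)
    also have "\<dots> = (\<Sum>k\<in>{..p}. ?c k) + (\<Sum>k\<in>{Suc p..Suc (p + q)}. ?c k)"
    proof -
      have "{..Suc (p + q)} = {..p} \<union> {Suc p..Suc (p + q)}" by auto
      then show ?thesis by (simp add: sum.union_disjoint del: sum.atMost_Suc)
    qed
    also have "(\<Sum>k\<in>{..p}. ?c k) = (\<Sum>k\<le>p. ?a k)"
      by (intro sum.cong) (auto simp: front_face_singular_face back_face_singular_face)
    also have "(\<Sum>k\<in>{Suc p..Suc (p + q)}. ?c k) = (\<Sum>k\<in>{Suc p..Suc (p + q)}. ?b (k - p))"
    proof (rule sum.cong)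
      fix k assume "k \<in> {Suc p..Suc (p + q)}"
      then have "p < k" "k - p \<le> Suc q" by auto
      then show "?c k = ?b (k - p)"
        using back_face_singular_face' [of "k - p" q p \<sigma>] by (simp add: front_face_singular_face')
    qed simp
    also have "\<dots> = (\<Sum>j\<in>{1..Suc q}. ?b j)"
      by (rule sum.reindex_bij_witness [of _ "\<lambda>i. i + p" "\<lambda>i. i - p"]) auto
    \<comment> \<open>Completing both sums adds the last face of the front part and the zeroth face
      of the back part. Both equal the product on the front p-face and the back q-face, hence cancel
      modulo 2.\<close>
    also have "(\<Sum>k\<le>p. ?a k) + (\<Sum>j\<in>{1..Suc q}. ?b j) = (\<Sum>k\<le>Suc p. ?a k) + (\<Sum>j\<le>Suc q. ?b j)"
    proof -
      have "back_face (Suc p) q \<sigma> = singular_face (Suc q) 0 ?B"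
        using back_face_singular_face' [of 0 q p \<sigma>] back_face_singular_face [of p p q \<sigma>] by simp
      then have "?a (Suc p) = ?b 0" by (simp add: singular_face_front_face)
      moreover have "(\<Sum>j\<le>Suc q. ?b j) = ?b 0 + (\<Sum>j\<in>{1..Suc q}. ?b j)"
        by (simp add: sum.atLeast_Suc_atMost atMost_atLeast0 del: sum.atMost_Suc)
      ultimately show ?thesis by (simp add: ac_simps)
    qed
    also have "(\<Sum>k\<le>Suc p. ?a k) = cup_cochain (Suc p) q X (coboundary p X \<phi>) \<psi> \<sigma>"
      using \<sigma> F by (simp add: cup_cochain_def on_simplices_def coboundary_def sum_distrib_right del: sum.atMost_Suc)
    also have "(\<Sum>j\<le>Suc q. ?b j) = cup_cochain p (Suc q) X \<phi> (coboundary q X \<psi>) \<sigma>"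
      using \<sigma> B by (simp add: cup_cochain_def on_simplices_def coboundary_def sum_distrib_left del: sum.atMost_Suc)
    finally show ?thesis .
  qed (simp_all add: coboundary_def on_simplices_def cup_cochain_def)
qed

section \<open>Cocycles, coboundaries and their classes\<close>

lemma cochain_set_add: "\<phi> \<in> cochain_set p X \<Longrightarrow> \<psi> \<in> cochain_set p X \<Longrightarrow> (\<lambda>\<sigma>. \<phi> \<sigma> + \<psi> \<sigma>) \<in> cochain_set p X"
  by (auto simp: cochain_set_def)

lemma coboundary_add:
  "coboundary p X (\<lambda>\<sigma>. \<phi> \<sigma> + \<psi> \<sigma>) = (\<lambda>\<sigma>. coboundary p X \<phi> \<sigma> + coboundary p X \<psi> \<sigma>)"
  by (auto simp: coboundary_def on_simplices_def sum.distrib fun_eq_iff simp del: sum.atMost_Suc)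

lemma coboundary_zero [simp]: "coboundary p X (\<lambda>\<sigma>. 0) = (\<lambda>\<sigma>. 0)"
  by (auto simp: coboundary_def on_simplices_def)

lemma coboundary_set_zero [simp]: "(\<lambda>\<sigma>. 0) \<in> coboundary_set p X"
  by (force simp: coboundary_set_def cochain_set_def split: nat.split intro: coboundary_zero [symmetric])

lemma coboundary_set_add:
  "\<phi> \<in> coboundary_set p X \<Longrightarrow> \<psi> \<in> coboundary_set p X \<Longrightarrow> (\<lambda>\<sigma>. \<phi> \<sigma> + \<psi> \<sigma>) \<in> coboundary_set p X"
  by (cases p) (auto simp: coboundary_set_def coboundary_add [symmetric] intro!: imageI cochain_set_add)

lemma on_simplices_in_cochain_set [simp]: "on_simplices p X \<phi> \<in> cochain_set p X"
  by (simp add: on_simplices_def cochain_set_def)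

lemma coboundary_in_cochain_set [simp]: "coboundary p X \<phi> \<in> cochain_set (Suc p) X"
  by (simp add: coboundary_def)

lemma cup_cochain_in_cochain_set [simp]: "cup_cochain p q X \<phi> \<psi> \<in> cochain_set (p + q) X"
  by (simp add: cup_cochain_def)

lemma coboundary_on_simplices: "coboundary p X (on_simplices p X \<phi>) = coboundary p X \<phi>"
  using singular_simplex_singular_face [of "Suc p" X]
  by (auto simp: coboundary_def on_simplices_def fun_eq_iff simp del: sum.atMost_Suc intro!: sum.cong)

text \<open>Primitives in \<open>coboundary_set\<close> must vanish off the simplices; cutting off
  an arbitrary function does not change its coboundary, since faces of simplices are
  simplices.\<close>

lemma coboundary_in_coboundary_set: "coboundary p X \<phi> \<in> coboundary_set (Suc p) X"
  unfolding coboundary_set_def nat.case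
  by (rule image_eqI [of _ _ "on_simplices p X \<phi>"]) (simp_all add: coboundary_on_simplices)

lemma coboundary_setE:
  assumes "\<phi> \<in> coboundary_set (Suc p) X"
  obtains \<psi> where "\<phi> = coboundary p X \<psi>"
  using assms by (auto simp: coboundary_set_def)

text \<open>Dual to the vanishing of the double boundary, through the pairing
  \<open>eval_chain\<close>.\<close>

lemma coboundary_coboundary: "coboundary (Suc p) X (coboundary p X \<phi>) = (\<lambda>\<sigma>. 0)"
proof
  fix \<sigma> :: "(nat \<Rightarrow> real) \<Rightarrow> 'a"
  show "coboundary (Suc p) X (coboundary p X \<phi>) \<sigma> = 0"
  proof (cases "singular_simplex (Suc (Suc p)) X \<sigma>")
    case True
    then have c: "singular_chain (Suc (Suc p)) X (frag_of \<sigma>)" by (simp add: singular_chain_of)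
    have "coboundary (Suc p) X (coboundary p X \<phi>) \<sigma> =
        eval_chain \<phi> (chain_boundary (Suc p) (chain_boundary (Suc (Suc p)) (frag_of \<sigma>)))"
      using eval_chain_coboundary [OF c, of "coboundary p X \<phi>"]
        eval_chain_coboundary [OF singular_chain_boundary_alt [OF c], of \<phi>] by simp
    then show ?thesis using chain_boundary_boundary [OF c] by simp
  qed (simp add: coboundary_def on_simplices_def)
qed

lemma coboundary_set_subset_cocycle_set: "coboundary_set p X \<subseteq> cocycle_set p X"
proof (cases p)
  case 0
  then show ?thesis by (simp add: coboundary_set_def cocycle_set_def cochain_set_def)
next
  case (Suc q)
  then show ?thesis by (auto elim!: coboundary_setE simp: cocycle_set_def coboundary_coboundary)
qed

lemma cocycle_set_add:
  "\<phi> \<in> cocycle_set p X \<Longrightarrow> \<psi> \<in> cocycle_set p X \<Longrightarrow> (\<lambda>\<sigma>. \<phi> \<sigma> + \<psi> \<sigma>) \<in> cocycle_set p X"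
  by (simp add: cocycle_set_def coboundary_add cochain_set_add)

lemma cohomology_class_iff:
  "\<phi> \<in> cohomology_class p X z \<longleftrightarrow> (\<exists>b\<in>coboundary_set p X. \<phi> = (\<lambda>\<sigma>. b \<sigma> + z \<sigma>))"
  by (auto simp: cohomology_class_def r_coset_def cocycle_group_def)

lemma cohomology_class_coboundary:
  assumes "z \<in> coboundary_set p X"
  shows "cohomology_class p X z = coboundary_set p X"
proof (intro subset_antisym subsetI)
  fix \<phi> assume "\<phi> \<in> coboundary_set p X"
  then have "(\<lambda>\<sigma>. \<phi> \<sigma> + z \<sigma>) \<in> coboundary_set p X"
    using assms by (rule coboundary_set_add)
  then show "\<phi> \<in> cohomology_class p X z"
    unfolding cohomology_class_iff by (rule rev_bexI) (simp add: add.assoc)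
qed (use assms in \<open>auto simp: cohomology_class_iff coboundary_set_add\<close>)

lemma one_cohomology_group: "\<one>\<^bsub>cohomology_group p X\<^esub> = coboundary_set p X"
  by (simp add: cohomology_group_def FactGroup_def)

lemma carrier_cohomology_groupE:
  assumes "A \<in> carrier (cohomology_group p X)"
  obtains z where "z \<in> cocycle_set p X" "A = cohomology_class p X z"
  using assms by (auto simp: cohomology_group_def FactGroup_def RCOSETS_def cohomology_class_def cocycle_group_def)

lemma cohomology_class_subset_cocycle_set:
  "z \<in> cocycle_set p X \<Longrightarrow> cohomology_class p X z \<subseteq> cocycle_set p X"
  using coboundary_set_subset_cocycle_set [of p X] by (auto simp: cohomology_class_iff intro!: cocycle_set_add)

lemma in_cohomology_class: "z \<in> cohomology_class p X z"
  by (auto simp: cohomology_class_iff intro!: bexI [of _ "\<lambda>\<sigma>. 0"])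

text \<open>The cochain whose class appears under the union in \<open>cohomology_induced\<close>;
  the algebra is done with it before passing to classes.\<close>

definition pull :: "nat \<Rightarrow> 'a topology \<Rightarrow> ('a \<Rightarrow> 'b) \<Rightarrow> 'b cochain \<Rightarrow> 'a cochain" where
  "pull p X g \<phi> = on_simplices p X (\<lambda>\<sigma>. \<phi> (simplex_map p g \<sigma>))"

lemma pull_add: "pull p X g (\<lambda>\<sigma>. \<phi> \<sigma> + \<psi> \<sigma>) = (\<lambda>\<sigma>. pull p X g \<phi> \<sigma> + pull p X g \<psi> \<sigma>)"
  by (auto simp: pull_def on_simplices_def)

lemma pull_in_cochain_set [simp]: "pull p X g \<phi> \<in> cochain_set p X"
  by (simp add: pull_def)

lemma singular_face_simplex_map':
  assumes "k \<le> Suc p"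
  shows "singular_face (Suc p) k (simplex_map (Suc p) g \<sigma>) = simplex_map p g (singular_face (Suc p) k \<sigma>)"
  unfolding singular_face_Suc simplex_map_def using assms
  by (auto simp: simplical_face_standard intro!: restrict_eqI)

lemma pull_coboundary:
  assumes "continuous_map X Y g"
  shows "pull (Suc p) X g (coboundary p Y \<phi>) = coboundary p X (pull p X g \<phi>)"
proof
  fix \<sigma> :: "(nat \<Rightarrow> real) \<Rightarrow> 'a"
  show "pull (Suc p) X g (coboundary p Y \<phi>) \<sigma> = coboundary p X (pull p X g \<phi>) \<sigma>"
  proof (cases "singular_simplex (Suc p) X \<sigma>")
    case True
    moreover have "singular_simplex p X (singular_face (Suc p) k \<sigma>)" if "k \<le> Suc p" for k
      using singular_simplex_singular_face [OF True _ that] by simp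
    ultimately show ?thesis
      using singular_simplex_simplex_map [OF True assms]
      by (simp add: pull_def coboundary_def on_simplices_def singular_face_simplex_map'
          del: sum.atMost_Suc)
  qed (simp add: pull_def coboundary_def on_simplices_def)
qed

lemma pull_coboundary_set:
  assumes "continuous_map X Y g" "\<phi> \<in> coboundary_set p Y"
  shows "pull p X g \<phi> \<in> coboundary_set p X"
proof (cases p)
  case 0
  then show ?thesis
    using assms(2) by (simp add: coboundary_set_def pull_def on_simplices_def)
next
  case (Suc q)
  then show ?thesis
    using assms pull_coboundary [OF assms(1), of q]
    by (auto elim!: coboundary_setE intro: coboundary_in_coboundary_set)
qed

lemma pull_cocycle_set:
  assumes "continuous_map X Y g" "\<phi> \<in> cocycle_set p Y"
  shows "pull p X g \<phi> \<in> cocycle_set p X"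
proof -
  have "coboundary p X (pull p X g \<phi>) = pull (Suc p) X g (coboundary p Y \<phi>)"
    by (simp only: pull_coboundary [OF assms(1)])
  also have "\<dots> = (\<lambda>\<sigma>. 0)"
    using assms(2) by (auto simp: cocycle_set_def pull_def on_simplices_def)
  finally show ?thesis by (simp add: cocycle_set_def)
qed

lemma front_face_simplex_map:
  "p \<le> n \<Longrightarrow> front_face p (simplex_map n g \<sigma>) = simplex_map p g (front_face p \<sigma>)"
  unfolding front_face_def simplex_map_def using standard_simplex_mono [of p n]
  by (intro restrict_eqI) auto

lemma back_face_simplex_map:
  "back_face p q (simplex_map (p + q) g \<sigma>) = simplex_map q g (back_face p q \<sigma>)"
  unfolding back_face_shift simplex_map_def
  by (intro restrict_eqI) (auto simp: shift_simplex_in_standard_simplex)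

lemma pull_cup:
  assumes "continuous_map X Y g"
  shows "pull (p + q) X g (cup_cochain p q Y \<phi> \<psi>) = cup_cochain p q X (pull p X g \<phi>) (pull q X g \<psi>)"
proof
  fix \<sigma> :: "(nat \<Rightarrow> real) \<Rightarrow> 'a"
  show "pull (p + q) X g (cup_cochain p q Y \<phi> \<psi>) \<sigma> = cup_cochain p q X (pull p X g \<phi>) (pull q X g \<psi>) \<sigma>"
    using singular_simplex_simplex_map [OF _ assms, of "p + q" \<sigma>] front_face_simplex [of "p + q" X \<sigma> p]
      back_face_simplex [of p q X \<sigma>]
    by (auto simp: pull_def cup_cochain_def on_simplices_def front_face_simplex_map back_face_simplex_map)
qed

section \<open>Products of cocycles and coboundaries\<close>

lemma cup_cochain_add:
  "cup_cochain p q X (\<lambda>\<sigma>. \<phi> \<sigma> + \<phi>' \<sigma>) \<psi> = (\<lambda>\<sigma>. cup_cochain p q X \<phi> \<psi> \<sigma> + cup_cochain p q X \<phi>' \<psi> \<sigma>)"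
  "cup_cochain p q X \<phi> (\<lambda>\<sigma>. \<psi> \<sigma> + \<psi>' \<sigma>) = (\<lambda>\<sigma>. cup_cochain p q X \<phi> \<psi> \<sigma> + cup_cochain p q X \<phi> \<psi>' \<sigma>)"
  by (auto simp: cup_cochain_def on_simplices_def fun_eq_iff algebra_simps)

lemma cup_cochain_zero [simp]:
  "cup_cochain p q X (\<lambda>\<sigma>. 0) \<psi> = (\<lambda>\<sigma>. 0)" "cup_cochain p q X \<phi> (\<lambda>\<sigma>. 0) = (\<lambda>\<sigma>. 0)"
  by (auto simp: cup_cochain_def on_simplices_def fun_eq_iff)

lemma cup_cocycle:
  assumes "\<phi> \<in> cocycle_set p X" "\<psi> \<in> cocycle_set q X"
  shows "cup_cochain p q X \<phi> \<psi> \<in> cocycle_set (p + q) X"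
  using assms by (simp add: cocycle_set_def coboundary_cup)

text \<open>If \<open>\<phi>\<close> is the coboundary of \<open>u\<close>, then by the Leibniz rule
  the product is the coboundary of the product of \<open>u\<close> and the cocycle
  \<open>\<psi>\<close>. In degree 0 the only coboundary is zero.\<close>

lemma cup_coboundary_left:
  assumes "\<phi> \<in> coboundary_set p X" "\<psi> \<in> cocycle_set q X"
  shows "cup_cochain p q X \<phi> \<psi> \<in> coboundary_set (p + q) X"
proof (cases p)
  case 0
  then show ?thesis using assms(1) by (simp add: coboundary_set_def [of 0])
next
  case (Suc r)
  then obtain u where u: "\<phi> = coboundary r X u" using assms(1) by (auto elim: coboundary_setE)
  have "coboundary (r + q) X (cup_cochain r q X u \<psi>) = cup_cochain p q X \<phi> \<psi>"
    using assms(2) by (simp add: coboundary_cup cocycle_set_def u Suc)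
  then show ?thesis
    using coboundary_in_coboundary_set [of "r + q" X "cup_cochain r q X u \<psi>"] by (simp add: Suc)
qed

lemma cup_coboundary_right:
  assumes "\<phi> \<in> cocycle_set p X" "\<psi> \<in> coboundary_set q X"
  shows "cup_cochain p q X \<phi> \<psi> \<in> coboundary_set (p + q) X"
proof (cases q)
  case 0
  then show ?thesis using assms(2) by (simp add: coboundary_set_def [of 0])
next
  case (Suc r)
  then obtain u where u: "\<psi> = coboundary r X u" using assms(2) by (auto elim: coboundary_setE)
  have "coboundary (p + r) X (cup_cochain p r X \<phi> u) = cup_cochain p q X \<phi> \<psi>"
    using assms(1) by (simp add: coboundary_cup cocycle_set_def u Suc)
  then show ?thesis
    using coboundary_in_coboundary_set [of "p + r" X "cup_cochain p r X \<phi> u"] by (simp add: Suc)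
qed

section \<open>Powers of a class that is trivial on an open cover\<close>

lemma cocycle_1_contractible:
  assumes X: "contractible_space X" and z: "z \<in> cocycle_set 1 X"
  shows "\<exists>a. z = coboundary 0 X a"
\<comment> \<open>The empty space counts as contractible but has no base point; there every cochain
  is zero.\<close>
proof (cases "topspace X = {}")
  case True
  then have "z = coboundary 0 X (\<lambda>\<sigma>. 0)"
    using z by (auto simp: cocycle_set_def cochain_set_def singular_simplex_empty)
  then show ?thesis by blast
next
  case False
  obtain b where hom: "homotopic_with (\<lambda>x. True) X X id (\<lambda>x. b)"
    using X by (auto simp: contractible_space_def)
  then have b: "b \<in> topspace X"
    using False homotopic_with_imp_continuous_maps [OF hom] by (auto simp: continuous_map_def)
  \<comment> \<open>All integral 1-cycles bound, so \<open>z\<close> integrated along chains from a base point is a primitive.\<close>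
  have cycle_boundary: "\<exists>d. singular_chain 2 X d \<and> chain_boundary 2 d = c"
    if c: "singular_relcycle 1 X {} c" for c
  proof -
    \<comment> \<open>Homotopy invariance: \<open>c\<close> is homologous to its image under the
      constant map to \<open>b\<close>, and in positive degree every cycle of a one-point space
      bounds.\<close>
    let ?k = "chain_map 1 (\<lambda>x. b) c"
    have "homologous_rel 1 X {} (chain_map 1 id c) ?k"
      by (rule homotopic_imp_homologous_rel_chain_maps [OF _ c]) (use hom in simp)
    moreover have "chain_map 1 id c = c"
      using c by (intro chain_map_id_gen [of _ X]) (auto simp: singular_cycle)
    moreover have "singular_relboundary 1 X {} ?k"
    proof -
      have tb: "topspace (subtopology X {b}) = {b}" using b by auto
      have "singular_relcycle 1 (subtopology X {b}) {} ?k"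
        using singular_relcycle_chain_map [OF c, of "subtopology X {b}" "\<lambda>x. b" "{}"] b
        by (simp add: continuous_map_in_subtopology)
      then have "singular_relboundary 1 (subtopology X {b}) {} ?k"
        using singular_boundary_eq_cycle_singleton [OF tb] by simp
      then show ?thesis
        using singular_boundary_mono [of "{b}" "topspace X" 1 X ?k] b by simp
    qed
    ultimately have "singular_relboundary 1 X {} c"
      using singular_relboundary_add [of 1 X "{}" "c - ?k" ?k] by (simp add: homologous_rel_def)
    then show ?thesis by (simp add: singular_boundary numeral_2_eq_2)
  qed
  \<comment> \<open>Path connectedness yields for every point a 1-chain \<open>D \<tau>\<close> from
    the base point to it.\<close>
  have pc: "path_connected_space X" by (rule contractible_imp_path_connected_space [OF X])
  let ?pt = "\<lambda>x. restrict (\<lambda>_. x) (standard_simplex 0)"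
  have pt: "singular_simplex 0 X (?pt b)" using b by (simp add: singular_simplex_def)
  have "\<exists>d. singular_simplex 0 X \<tau> \<longrightarrow> singular_chain 1 X d \<and> chain_boundary 1 d = frag_of \<tau> - frag_of (?pt b)" for \<tau>
    using iso_integer_zeroth_homology_group_aux [OF pc _ pt, of \<tau>]
    by (auto simp: homologous_rel_def singular_boundary)
  then obtain D where D: "\<And>\<tau>. singular_simplex 0 X \<tau> \<Longrightarrow>
      singular_chain 1 X (D \<tau>) \<and> chain_boundary 1 (D \<tau>) = frag_of \<tau> - frag_of (?pt b)"
    by metis
  have "z \<sigma> = coboundary 0 X (\<lambda>\<tau>. eval_chain z (D \<tau>)) \<sigma>" for \<sigma>
  proof (cases "singular_simplex 1 X \<sigma>")
    case \<sigma>: True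
    let ?f = "\<lambda>k. singular_face 1 k \<sigma>"
    have f: "singular_simplex 0 X (?f 0)" "singular_simplex 0 X (?f 1)"
      using singular_simplex_singular_face [OF \<sigma>, of 0] singular_simplex_singular_face [OF \<sigma>, of 1] by auto
    \<comment> \<open>The simplex closed up by the chains to its two endpoints; the base points
      cancel, so this is a cycle.\<close>
    let ?c = "frag_of \<sigma> - (D (?f 0) - D (?f 1))"
    have "chain_boundary 1 (frag_of \<sigma>) = frag_of (?f 0) - frag_of (?f 1)"
      by (simp add: chain_boundary_of)
    then have "singular_relcycle 1 X {} ?c"
      using D f \<sigma> by (simp add: singular_cycle chain_boundary_diff singular_chain_diff singular_chain_of)
    then obtain d where "singular_chain 2 X d" "chain_boundary 2 d = ?c"
      using cycle_boundary by blast
    then have "eval_chain z ?c = 0"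
      using eval_chain_cocycle_boundary [OF z, of d] by (simp add: numeral_2_eq_2)
    then show ?thesis
      using \<sigma> by (simp add: eval_chain_diff coboundary_def on_simplices_def)
  next
    case False
    then show ?thesis
      using z by (simp add: coboundary_def on_simplices_def cocycle_set_def cochain_set_def)
  qed
  then show ?thesis by blast
qed

text \<open>Guards against a degenerate union: over an empty set, \<open>cohomology_induced\<close>
  would be empty and thus not the zero class.\<close>

lemma cup_power_nonempty:
  assumes "A \<noteq> {}" shows "cup_power R A k \<noteq> {}"
proof (induction k)
  case 0
  show ?case using in_cohomology_class by (auto simp: unit_class_def)
next
  case (Suc k)
  then obtain \<phi> \<psi> where "\<phi> \<in> cup_power R A k" "\<psi> \<in> A" using assms by auto
  then show ?case
    using in_cohomology_class [of "cup_cochain k 1 R \<phi> \<psi>" "k + 1" R] by (auto simp: cup_def)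
qed

text \<open>On \<open>U i\<close> the i-th factor \<open>\<psi>\<close> is a coboundary \<open>\<delta>a\<close>; replacing it by \<open>\<psi> - \<delta>a\<close>, with \<open>a\<close> extended to
  \<open>X\<close>, makes it vanish on the simplices in \<open>U i\<close>, and then so does the product.\<close>

lemma cup_power_cohomologous_small:
  assumes g: "continuous_map X R g"
    and A: "A \<subseteq> cocycle_set 1 R"
    and triv: "\<And>\<psi> i. \<psi> \<in> A \<Longrightarrow> i < n \<Longrightarrow>
      \<exists>a. \<forall>\<sigma>. singular_simplex 1 (subtopology X (U i)) \<sigma> \<longrightarrow> pull 1 X g \<psi> \<sigma> = coboundary 0 X a \<sigma>"
  shows "k \<le> n \<Longrightarrow> \<phi> \<in> cup_power R A k \<Longrightarrow>
    \<exists>T\<in>cocycle_set k X. \<exists>e\<in>coboundary_set k X. pull k X g \<phi> = (\<lambda>\<sigma>. T \<sigma> + e \<sigma>) \<and>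
      (\<forall>i<k. \<forall>\<sigma>. singular_simplex k (subtopology X (U i)) \<sigma> \<longrightarrow> T \<sigma> = 0)"
proof (induction k arbitrary: \<phi>)
  \<comment> \<open>In degree 0 the zero cochain is the only coboundary, so the unit class has a
    single representative; the vanishing condition is vacuous.\<close>
  case 0
  then have "\<phi> = on_simplices 0 R (\<lambda>\<sigma>. 1)"
    by (auto simp: unit_class_def cohomology_class_iff coboundary_set_def)
  moreover have "pull 0 X g (on_simplices 0 R (\<lambda>\<sigma>. 1)) \<in> cocycle_set 0 X"
  proof (rule pull_cocycle_set [OF g])
    have "coboundary 0 R (\<lambda>\<sigma>. 1) = (\<lambda>\<sigma>. 0)"
      by (auto simp: coboundary_def on_simplices_def)
    then show "on_simplices 0 R (\<lambda>\<sigma>. 1) \<in> cocycle_set 0 R"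
      by (simp add: cocycle_set_def coboundary_on_simplices)
  qed
  ultimately show ?case
    by (intro bexI [of _ "pull 0 X g \<phi>"] bexI [of _ "\<lambda>\<sigma>. 0"]) auto
next
  case (Suc k)
  \<comment> \<open>An arbitrary element of the union comes with its own representatives and a
    correcting coboundary \<open>b\<close>, so the factors \<open>\<psi>\<close> may differ from
    stage to stage.\<close>
  then obtain \<rho> \<psi> b where \<rho>: "\<rho> \<in> cup_power R A k" and \<psi>: "\<psi> \<in> A"
    and b: "b \<in> coboundary_set (k + 1) R" and \<phi>: "\<phi> = (\<lambda>\<sigma>. b \<sigma> + cup_cochain k 1 R \<rho> \<psi> \<sigma>)"
    by (auto simp: cup_def cohomology_class_iff)
  obtain T e where T: "T \<in> cocycle_set k X" and e: "e \<in> coboundary_set k X"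
    and \<rho>_eq: "pull k X g \<rho> = (\<lambda>\<sigma>. T \<sigma> + e \<sigma>)"
    and T0: "\<And>i \<sigma>. i < k \<Longrightarrow> singular_simplex k (subtopology X (U i)) \<sigma> \<Longrightarrow> T \<sigma> = 0"
    using Suc.IH [OF _ \<rho>] Suc.prems(1) by auto
  obtain a where a: "\<And>\<sigma>. singular_simplex 1 (subtopology X (U k)) \<sigma> \<Longrightarrow> pull 1 X g \<psi> \<sigma> = coboundary 0 X a \<sigma>"
    using triv [OF \<psi>, of k] Suc.prems(1) by auto
  define v where "v = coboundary 0 X a"
  have v: "v \<in> coboundary_set 1 X" using coboundary_in_coboundary_set [of 0 X a] by (simp add: v_def)
  define t where "t = (\<lambda>\<sigma>. pull 1 X g \<psi> \<sigma> + v \<sigma>)"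
  have p\<psi>: "pull 1 X g \<psi> \<in> cocycle_set 1 X" using pull_cocycle_set [OF g] \<psi> A by blast
  have t: "t \<in> cocycle_set 1 X"
    unfolding t_def using p\<psi> v coboundary_set_subset_cocycle_set by (blast intro: cocycle_set_add)
  have p\<psi>_eq: "pull 1 X g \<psi> = (\<lambda>\<sigma>. t \<sigma> + v \<sigma>)" by (simp add: t_def add.assoc)
  define T' where "T' = cup_cochain k 1 X T t"
  \<comment> \<open>Expanding the product of \<open>T + e\<close> and \<open>t + v\<close>:
    everything except \<open>T'\<close> has a coboundary as a factor, or is the pullback of
    \<open>b\<close>.\<close>
  define e' where "e' = (\<lambda>\<sigma>. pull (k + 1) X g b \<sigma> + (cup_cochain k 1 X T v \<sigma> + cup_cochain k 1 X e (pull 1 X g \<psi>) \<sigma>))"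
  have "T' \<in> cocycle_set (Suc k) X" using cup_cocycle [OF T t] by (simp add: T'_def)
  moreover have "e' \<in> coboundary_set (k + 1) X"
    unfolding e'_def
    by (intro coboundary_set_add pull_coboundary_set [OF g b] cup_coboundary_right [OF T v]
        cup_coboundary_left [OF e p\<psi>])
  moreover have "pull (k + 1) X g \<phi> = (\<lambda>\<sigma>. T' \<sigma> + e' \<sigma>)"
  proof -
    have "pull (k + 1) X g \<phi> = (\<lambda>\<sigma>. pull (k + 1) X g b \<sigma> +
        cup_cochain k 1 X (pull k X g \<rho>) (pull 1 X g \<psi>) \<sigma>)"
      by (simp only: \<phi> pull_add pull_cup [OF g])
    also have "\<dots> = (\<lambda>\<sigma>. pull (k + 1) X g b \<sigma> +
        (cup_cochain k 1 X T (\<lambda>\<sigma>. t \<sigma> + v \<sigma>) \<sigma> + cup_cochain k 1 X e (pull 1 X g \<psi>) \<sigma>))"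
      by (simp only: \<rho>_eq cup_cochain_add(1) flip: p\<psi>_eq)
    finally show ?thesis
      by (simp only: cup_cochain_add(2) T'_def e'_def) (simp add: ac_simps)
  qed
  moreover have "T' \<sigma> = 0" if "i < Suc k" and \<sigma>: "singular_simplex (Suc k) (subtopology X (U i)) \<sigma>" for i \<sigma>
  proof -
    have F: "singular_simplex k (subtopology X (U i)) (front_face k \<sigma>)"
      by (rule front_face_simplex [OF \<sigma>]) simp
    have B: "singular_simplex 1 (subtopology X (U i)) (back_face k 1 \<sigma>)"
      by (rule back_face_simplex) (use \<sigma> in simp)
    \<comment> \<open>The new factor takes care of \<open>U k\<close>, the earlier ones of
      \<open>U i\<close> with \<open>i < k\<close>.\<close>
    have "T (front_face k \<sigma>) = 0 \<or> t (back_face k 1 \<sigma>) = 0"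
    proof (cases "i = k")
      case True
      with a [of "back_face k 1 \<sigma>"] B show ?thesis by (simp add: t_def v_def)
    next
      case False
      with T0 [OF _ F] that show ?thesis by simp
    qed
    then show ?thesis by (auto simp: T'_def cup_cochain_def on_simplices_def)
  qed
  ultimately show ?case
    by (intro bexI [of _ T'] bexI [of _ e']) auto
qed

text \<open>Up to a coboundary, the pullback of each representative vanishes on simplices inside any
  \<open>U i\<close>, hence is itself a coboundary as the \<open>U i\<close> cover \<open>X\<close>.
  So all classes in the union coincide with the zero class.\<close>

lemma cup_power_induced_eq_one:
  assumes g: "continuous_map X R g" and n: "0 < n"
    and A: "A \<in> carrier (cohomology_group 1 R)"
    and opn: "\<And>i. i < n \<Longrightarrow> openin X (U i)" and cover: "topspace X \<subseteq> (\<Union>i<n. U i)"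
    and triv: "\<And>\<psi> i. \<psi> \<in> cocycle_set 1 R \<Longrightarrow> i < n \<Longrightarrow>
      \<exists>a. \<forall>\<sigma>. singular_simplex 1 (subtopology X (U i)) \<sigma> \<longrightarrow> pull 1 X g \<psi> \<sigma> = coboundary 0 X a \<sigma>"
  shows "cohomology_induced n X g (cup_power R A n) = \<one>\<^bsub>cohomology_group n X\<^esub>"
proof -
  obtain z where z: "z \<in> cocycle_set 1 R" and Az: "A = cohomology_class 1 R z"
    using A by (rule carrier_cohomology_groupE)
  have A1: "A \<subseteq> cocycle_set 1 R" unfolding Az by (rule cohomology_class_subset_cocycle_set [OF z])
  obtain p where p: "n = Suc p" using n by (cases n) auto
  have "pull n X g \<phi> \<in> coboundary_set n X" if \<phi>: "\<phi> \<in> cup_power R A n" for \<phi>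
  proof -
    obtain T e where T: "T \<in> cocycle_set n X" and e: "e \<in> coboundary_set n X"
      and eq: "pull n X g \<phi> = (\<lambda>\<sigma>. T \<sigma> + e \<sigma>)"
      and T0: "\<And>i \<sigma>. i < n \<Longrightarrow> singular_simplex n (subtopology X (U i)) \<sigma> \<Longrightarrow> T \<sigma> = 0"
      using cup_power_cohomologous_small [where U = U and n = n, OF g A1 _ order_refl \<phi>] triv A1 by blast
    have "T \<in> coboundary_set (Suc p) X"
    proof (rule cocycle_vanishing_on_small_simplices [of "U ` {..<n}"])
      show "T \<sigma> = 0" if "V \<in> U ` {..<n}" "singular_simplex (Suc p) (subtopology X V) \<sigma>" for \<sigma> V
        using that T0 p by auto
    qed (use opn cover T p in auto)
    then show ?thesis unfolding eq using e p by (intro coboundary_set_add) auto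
  qed
  moreover have "cup_power R A n \<noteq> {}"
    using in_cohomology_class [of z 1 R] Az by (intro cup_power_nonempty) auto
  ultimately show ?thesis
    by (auto simp: cohomology_induced_def one_cohomology_group cohomology_class_coboundary simp flip: pull_def)
qed

section \<open>Orbit spaces of odd maps to spheres\<close>

lemma topspace_orbit_space [simp]: "topspace (orbit_space Y a) = orbit a ` topspace Y"
proof
  show "topspace (orbit_space Y a) \<subseteq> orbit a ` topspace Y"
    using openin_topspace [of "orbit_space Y a"] by (simp only: openin_orbit_space)
  have "{y \<in> topspace Y. orbit a y \<in> orbit a ` topspace Y} = topspace Y" by auto
  then have "openin (orbit_space Y a) (orbit a ` topspace Y)"
    by (simp add: openin_orbit_space)
  then show "orbit a ` topspace Y \<subseteq> topspace (orbit_space Y a)"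
    by (rule openin_subset)
qed

text \<open>The universal property of the quotient topology.\<close>

lemma continuous_map_from_orbit_space:
  "continuous_map (orbit_space Y a) Z f \<longleftrightarrow> continuous_map Y Z (f \<circ> orbit a)"
proof -
  have "openin (orbit_space Y a) {x \<in> orbit a ` topspace Y. f x \<in> U} \<longleftrightarrow>
      openin Y {y \<in> topspace Y. f (orbit a y) \<in> U}" for U
  proof -
    have "{y \<in> topspace Y. orbit a y \<in> {x \<in> orbit a ` topspace Y. f x \<in> U}} =
        {y \<in> topspace Y. f (orbit a y) \<in> U}" by auto
    then show ?thesis unfolding openin_orbit_space by auto
  qed
  then show ?thesis by (auto simp: continuous_map_def)
qed

lemma continuous_map_orbit: "continuous_map Y (orbit_space Y a) (orbit a)"
  using continuous_map_from_orbit_space [of Y a "orbit_space Y a" id] by simp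

lemma image_orbit: "h (a y) = b (h y) \<Longrightarrow> h ` orbit a y = orbit b (h y)"
  by (simp add: orbit_def)

lemma odd_map_imp_continuous_map_orbit_space:
  assumes "odd_map Y a Z b h"
  shows "continuous_map (orbit_space Y a) (orbit_space Z b) (image h)"
proof -
  have "continuous_map Y (orbit_space Z b) (orbit b \<circ> h)"
    using assms by (intro continuous_map_compose [OF _ continuous_map_orbit]) (simp add: odd_map_def)
  then show ?thesis
    unfolding continuous_map_from_orbit_space
    by (rule continuous_map_eq) (use assms in \<open>auto simp: odd_map_def image_orbit\<close>)
qed

lemma topspace_sphere_infty: "topspace sphere_infty = (\<Union>p. topspace (nsphere p))"
proof
  show "topspace sphere_infty \<subseteq> (\<Union>p. topspace (nsphere p))"
    using openin_topspace [of sphere_infty] unfolding openin_sphere_infty by blast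
  have "(\<Union>p. topspace (nsphere p)) \<inter> topspace (nsphere q) = topspace (nsphere q)" for q by auto
  then have "openin sphere_infty (\<Union>p. topspace (nsphere p))"
    by (simp add: openin_sphere_infty)
  then show "(\<Union>p. topspace (nsphere p)) \<subseteq> topspace sphere_infty"
    by (rule openin_subset)
qed

lemma continuous_map_nsphere_sphere_infty: "continuous_map (nsphere m) sphere_infty id"
  unfolding continuous_map_def
proof (intro conjI allI impI)
  fix U assume "openin sphere_infty U"
  then have "openin (nsphere m) (U \<inter> topspace (nsphere m))"
    by (simp add: openin_sphere_infty)
  moreover have "{x \<in> topspace (nsphere m). id x \<in> U} = U \<inter> topspace (nsphere m)" by auto
  ultimately show "openin (nsphere m) {x \<in> topspace (nsphere m). id x \<in> U}" by simp
qed (auto simp: topspace_sphere_infty)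

lemma orbit_antipode_sgn:
  assumes "x i \<noteq> 0" shows "orbit antipode (\<lambda>j. sgn (x i) * x j) = orbit antipode x"
  using assms by (auto simp: orbit_def antipode_def sgn_if fun_eq_iff)

text \<open>The sphere \<open>nsphere m\<close> has \<open>Suc m\<close> coordinates, hence a cover
  by \<open>Suc m\<close> sets. With \<open>g\<close> as the map into the infinite sphere,
  \<open>k = Suc m\<close> is admissible and contributes the value \<open>m\<close>.\<close>

lemma cohomological_index_le:
  assumes g: "odd_map Y a (nsphere m) antipode g"
  shows "cohomological_index Y a \<le> ereal (real m)"
proof -
  let ?X = "orbit_space Y a"
  have cg: "continuous_map Y (nsphere m) g" and odd: "\<And>y. y \<in> topspace Y \<Longrightarrow> g (a y) = antipode (g y)"
    using g by (auto simp: odd_map_def)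
  have h: "odd_map Y a sphere_infty antipode g"
    using continuous_map_compose [OF cg continuous_map_nsphere_sphere_infty] odd
    by (simp add: odd_map_def)
  have coord: "continuous_map Y euclideanreal (\<lambda>y. g y i)" for i
    using continuous_map_compose [OF cg continuous_map_nsphere_projection [of m i]] by (simp add: comp_def)
  define U where "U i = orbit a ` {y \<in> topspace Y. g y i \<noteq> 0}" for i
  \<comment> \<open>By oddness the condition on the i-th coordinate is the same at both points of an
    orbit, so the set upstairs is saturated and \<open>U i\<close> is open.\<close>
  have pre_U: "{y \<in> topspace Y. orbit a y \<in> U i} = {y \<in> topspace Y. g y i \<noteq> 0}" for i
  proof -
    have "g y i \<noteq> 0" if "y \<in> topspace Y" "y' \<in> topspace Y" "g y' i \<noteq> 0" "orbit a y = orbit a y'" for y y'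
      using that odd [of y] odd [of y'] by (auto simp: orbit_def doubleton_eq_iff antipode_def)
    then show ?thesis by (auto simp: U_def)
  qed
  have opnY: "openin Y {y \<in> topspace Y. g y i \<noteq> 0}" for i
    using openin_continuous_map_preimage [OF coord, of "- {0}" i] by (simp add: open_Compl)
  have opn: "openin ?X (U i)" for i
    unfolding openin_orbit_space pre_U using opnY by (auto simp: U_def)
  have cover: "topspace ?X \<subseteq> (\<Union>i<Suc m. U i)"
  proof -
    have "\<exists>i<Suc m. g y i \<noteq> 0" if "y \<in> topspace Y" for y
    proof (rule ccontr)
      assume "\<not> ?thesis"
      moreover have "(\<Sum>i\<le>m. (g y i)\<^sup>2) = 1"
        using continuous_map_image_subset_topspace [OF cg] that by (auto simp: nsphere)
      ultimately show False by simp
    qed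
    then show ?thesis by (force simp: U_def)
  qed
  have triv: "\<exists>a. \<forall>\<sigma>. singular_simplex 1 (subtopology ?X (U i)) \<sigma> \<longrightarrow> pull 1 ?X (image g) \<psi> \<sigma> = coboundary 0 ?X a \<sigma>"
    if \<psi>: "\<psi> \<in> cocycle_set 1 RP_infty" and i: "i < Suc m" for \<psi> i
  proof -
    \<comment> \<open>Choosing the representative with positive i-th coordinate factors \<open>U i \<rightarrow> RP_infty\<close> through
      the contractible hemisphere \<open>H\<close>.\<close>
    define H where "H = subtopology (nsphere m) {x. x i \<ge> 0}"
    define s where "s C = (\<lambda>j. sgn (g (SOME y. y \<in> C) i) * g (SOME y. y \<in> C) j)" for C
    \<comment> \<open>The arbitrary choice is harmless: passing to the other point of the orbit
      changes the sign of both factors.\<close>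
    have s: "s (orbit a y) = (\<lambda>j. sgn (g y i) * g y j)" if "y \<in> topspace Y" for y
    proof -
      have "(SOME y'. y' \<in> orbit a y) \<in> orbit a y"
        by (rule someI [of _ y]) (simp add: orbit_def)
      then show ?thesis
        using odd [OF that] by (auto simp: s_def orbit_def antipode_def sgn_minus)
    qed
    have q: "continuous_map H RP_infty (orbit antipode)"
      unfolding H_def RP_infty_def
      using continuous_map_compose [OF continuous_map_nsphere_sphere_infty continuous_map_orbit]
      by (intro continuous_map_from_subtopology) simp
    have "\<exists>b. pull 1 H (orbit antipode) \<psi> = coboundary 0 H b"
      using contractible_space_upper_hemisphere [of i m] i
      by (intro cocycle_1_contractible pull_cocycle_set [OF q \<psi>]) (simp add: H_def)
    then obtain b where b: "pull 1 H (orbit antipode) \<psi> = coboundary 0 H b" ..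
    have s_in: "(\<lambda>j. sgn (g y i) * g y j) \<in> topspace H" if "y \<in> topspace Y" "g y i \<noteq> 0" for y
      using continuous_map_image_subset_topspace [OF cg] that
      by (auto simp: H_def nsphere power_mult_distrib sgn_if split: if_splits)
    have cs: "continuous_map (subtopology ?X (U i)) H s"
      unfolding continuous_map_def
    proof (intro conjI allI impI)
      show "s \<in> topspace (subtopology ?X (U i)) \<rightarrow> topspace H"
        using s_in by (auto simp: U_def s)
      fix W assume W: "openin H W"
      have eq: "{x \<in> topspace (subtopology ?X (U i)). s x \<in> W} =
          {x \<in> U i. s x \<in> W}" by (auto simp: U_def)
      \<comment> \<open>As \<open>U i\<close> is open, continuity of \<open>s\<close> can be tested
        on its open preimage in \<open>Y\<close>.\<close>
      let ?YU = "subtopology Y {y \<in> topspace Y. g y i \<noteq> 0}"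
      have "continuous_map ?YU (nsphere m) (\<lambda>y j. sgn (g y i) * g y j)"
      proof -
        \<comment> \<open>Off the zero set of the i-th coordinate this quotient equals
          \<open>sgn\<close>, and it is visibly continuous.\<close>
        have "continuous_map ?YU euclideanreal (\<lambda>y. \<bar>g y i\<bar> / g y i * g y j)" for j
          by (intro continuous_intros continuous_map_from_subtopology coord) auto
        then have "continuous_map ?YU (powertop_real UNIV) (\<lambda>y j. sgn (g y i) * g y j)"
          unfolding continuous_map_componentwise_UNIV
          by (force intro: continuous_map_eq simp: sgn_if)
        then show ?thesis
          unfolding nsphere continuous_map_in_subtopology
          using s_in by (auto simp: H_def nsphere)
      qed
      then have "continuous_map ?YU H (\<lambda>y j. sgn (g y i) * g y j)"
        using s_in by (auto simp: H_def continuous_map_in_subtopology)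
      then have "openin ?YU {y \<in> topspace ?YU. (\<lambda>j. sgn (g y i) * g y j) \<in> W}"
        using W by (rule openin_continuous_map_preimage)
      then have "openin Y {y \<in> topspace ?YU. (\<lambda>j. sgn (g y i) * g y j) \<in> W}"
        using opnY openin_trans_full by blast
      moreover have "{y \<in> topspace Y. orbit a y \<in> {x \<in> U i. s x \<in> W}} =
          {y \<in> topspace ?YU. (\<lambda>j. sgn (g y i) * g y j) \<in> W}"
        using pre_U [of i] by (auto simp: s)
      ultimately have "openin ?X {x \<in> U i. s x \<in> W}"
        unfolding openin_orbit_space by (auto simp: U_def)
      then show "openin (subtopology ?X (U i)) {x \<in> topspace (subtopology ?X (U i)). s x \<in> W}"
        unfolding eq by (auto simp: openin_subtopology_alt)
    qed
    have factor: "orbit antipode (s x) = g ` x" if x: "x \<in> topspace (subtopology ?X (U i))" for x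
    proof -
      obtain y where y: "y \<in> topspace Y" "g y i \<noteq> 0" "x = orbit a y" using x by (auto simp: U_def)
      then show ?thesis using orbit_antipode_sgn [of "g y" i] by (simp add: s image_orbit odd)
    qed
    \<comment> \<open>The primitive on \<open>U i\<close> is the pullback along \<open>s\<close> of
      a primitive on the hemisphere. At a simplex inside \<open>U i\<close> the coboundaries in
      \<open>U i\<close> and in the whole space agree, both being the sum over the faces.\<close>
    have "pull 1 ?X (image g) \<psi> \<sigma> = coboundary 0 ?X (pull 0 (subtopology ?X (U i)) s b) \<sigma>"
      if \<sigma>: "singular_simplex 1 (subtopology ?X (U i)) \<sigma>" for \<sigma>
    proof -
      have \<sigma>X: "singular_simplex 1 ?X \<sigma>" using \<sigma> by (simp add: singular_simplex_subtopology)
      have "simplex_map 1 (image g) \<sigma> = simplex_map 1 (orbit antipode \<circ> s) \<sigma>"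
        by (rule simplex_map_eq [OF \<sigma>]) (simp add: factor)
      then have "pull 1 ?X (image g) \<psi> \<sigma> = \<psi> (simplex_map 1 (orbit antipode) (simplex_map 1 s \<sigma>))"
        using \<sigma>X by (simp add: pull_def on_simplices_def simplex_map_compose)
      also have "\<dots> = coboundary 0 H b (simplex_map 1 s \<sigma>)"
        using singular_simplex_simplex_map [OF \<sigma> cs] by (simp add: pull_def on_simplices_def flip: b)
      also have "\<dots> = pull 1 (subtopology ?X (U i)) s (coboundary 0 H b) \<sigma>"
        using \<sigma> by (simp add: pull_def on_simplices_def)
      also have "\<dots> = coboundary 0 (subtopology ?X (U i)) (pull 0 (subtopology ?X (U i)) s b) \<sigma>"
        using pull_coboundary [OF cs, of 0 b] by simp
      also have "\<dots> = coboundary 0 ?X (pull 0 (subtopology ?X (U i)) s b) \<sigma>"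
        using \<sigma> \<sigma>X by (simp add: coboundary_def on_simplices_def)
      finally show ?thesis .
    qed
    then show ?thesis by blast
  qed
  have "cohomology_induced (Suc m) ?X (image g) (cup_power RP_infty t (Suc m)) = \<one>\<^bsub>cohomology_group (Suc m) ?X\<^esub>"
    if "t \<in> carrier (cohomology_group 1 RP_infty)" for t
    by (rule cup_power_induced_eq_one [OF _ _ that opn cover triv])
       (use odd_map_imp_continuous_map_orbit_space [OF h] in \<open>auto simp: RP_infty_def\<close>)
  then show ?thesis
    unfolding cohomological_index_def using h
    by (intro Inf_lower) (auto intro!: exI [of _ "Suc m"])
qed

section \<open>The Wasserstein metric and expectations\<close>

definition coupling :: "'a pmf \<Rightarrow> 'a pmf \<Rightarrow> ('a \<times> 'a) pmf \<Rightarrow> bool" where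
  "coupling \<mu> \<nu> \<gamma> \<longleftrightarrow> map_pmf fst \<gamma> = \<mu> \<and> map_pmf snd \<gamma> = \<nu>"

definition cost :: "('a::metric_space \<times> 'a) pmf \<Rightarrow> real" where
  "cost \<gamma> = measure_pmf.expectation \<gamma> (\<lambda>(x, y). dist x y)"

lemma wasserstein1_cost: "wasserstein1 \<mu> \<nu> = Inf (cost ` Collect (coupling \<mu> \<nu>))"
  by (simp add: wasserstein1_def cost_def coupling_def image_Collect)

lemma cost_nonneg: "0 \<le> cost \<gamma>"
  unfolding cost_def by (intro Bochner_Integration.integral_nonneg) auto

lemma coupling_pair_pmf: "coupling \<mu> \<nu> (pair_pmf \<mu> \<nu>)"
  by (simp add: coupling_def map_fst_pair_pmf map_snd_pair_pmf)

lemma wasserstein1_le_cost: "coupling \<mu> \<nu> \<gamma> \<Longrightarrow> wasserstein1 \<mu> \<nu> \<le> cost \<gamma>"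
  unfolding wasserstein1_cost by (intro cInf_lower bdd_belowI [of _ 0]) (auto simp: cost_nonneg)

lemma wasserstein1_lessE:
  assumes "wasserstein1 \<mu> \<nu> < r"
  obtains \<gamma> where "coupling \<mu> \<nu> \<gamma>" "cost \<gamma> < r"
proof -
  have "cost ` Collect (coupling \<mu> \<nu>) \<noteq> {}" using coupling_pair_pmf by blast
  from cInf_lessD [OF this] assms that show ?thesis by (auto simp: wasserstein1_cost)
qed

lemma wasserstein1_nonneg: "0 \<le> wasserstein1 \<mu> \<nu>"
  unfolding wasserstein1_cost using coupling_pair_pmf by (intro cInf_greatest) (auto simp: cost_nonneg)

lemma wasserstein1_commute: "wasserstein1 \<mu> \<nu> = wasserstein1 \<nu> \<mu>"
proof -
  have le: "wasserstein1 \<mu> \<nu> \<le> wasserstein1 \<nu> \<mu>" for \<mu> \<nu> :: "'a pmf"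
  proof (rule field_le_epsilon)
    fix e :: real assume "0 < e"
    then obtain \<gamma> where \<gamma>: "coupling \<nu> \<mu> \<gamma>" "cost \<gamma> < wasserstein1 \<nu> \<mu> + e"
      using wasserstein1_lessE [of \<nu> \<mu> "wasserstein1 \<nu> \<mu> + e"] by auto
    have "coupling \<mu> \<nu> (map_pmf prod.swap \<gamma>)"
      using \<gamma>(1) by (auto simp: coupling_def pmf.map_comp comp_def)
    moreover have "cost (map_pmf prod.swap \<gamma>) = cost \<gamma>"
      by (simp add: cost_def case_prod_unfold dist_commute)
    ultimately show "wasserstein1 \<mu> \<nu> \<le> wasserstein1 \<nu> \<mu> + e"
      using wasserstein1_le_cost \<gamma>(2) by fastforce
  qed
  show ?thesis by (intro antisym le)
qed

lemma coupling_support: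
  assumes "coupling \<mu> \<nu> \<gamma>" shows "set_pmf \<gamma> \<subseteq> set_pmf \<mu> \<times> set_pmf \<nu>"
  using assms by (force simp: coupling_def)

lemma coupling_finite:
  "\<lbrakk>coupling \<mu> \<nu> \<gamma>; finite (set_pmf \<mu>); finite (set_pmf \<nu>)\<rbrakk> \<Longrightarrow> finite (set_pmf \<gamma>)"
  by (rule finite_subset [OF coupling_support]) auto

text \<open>The gluing lemma: draw a pair from \<open>\<gamma>\<close>, then the third point from
  \<open>\<gamma>'\<close> conditioned on its first coordinate being the second point of the
  pair.\<close>

lemma coupling_glue:
  assumes "coupling \<mu> \<nu> \<gamma>" "coupling \<nu> \<rho> \<gamma>'"
  obtains \<eta> where "map_pmf (\<lambda>(x, y, z). (x, y)) \<eta> = \<gamma>" "map_pmf (\<lambda>(x, y, z). (y, z)) \<eta> = \<gamma>'"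
proof -
  define C where "C y = cond_pmf \<gamma>' {p. fst p = y}" for y
  define \<eta> where "\<eta> = bind_pmf \<gamma> (\<lambda>(x, y). map_pmf (\<lambda>p. (x, y, snd p)) (C y))"
  have \<nu>: "\<nu> = map_pmf snd \<gamma>" "\<nu> = map_pmf fst \<gamma>'" using assms by (auto simp: coupling_def)
  \<comment> \<open>Conditioning is legitimate, since every such \<open>y\<close> has positive
    mass.\<close>
  have ne: "set_pmf \<gamma>' \<inter> {p. fst p = y} \<noteq> {}" if "y \<in> set_pmf \<nu>" for y
    using that by (auto simp: \<nu>(2))
  have "map_pmf (\<lambda>(x, y, z). (x, y)) \<eta> = bind_pmf \<gamma> return_pmf"
    unfolding \<eta>_def map_bind_pmf by (intro bind_pmf_cong) (auto simp: pmf.map_comp comp_def)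
  moreover have "map_pmf (\<lambda>(x, y, z). (y, z)) \<eta> = \<gamma>'"
  proof -
    have fst: "fst p = y" if "y \<in> set_pmf \<nu>" "p \<in> set_pmf (C y)" for p y
      using that set_cond_pmf [OF ne [OF that(1)]] by (auto simp: C_def)
    have "map_pmf (\<lambda>(x, y, z). (y, z)) \<eta> = bind_pmf \<gamma> (\<lambda>q. C (snd q))"
      unfolding \<eta>_def map_bind_pmf
    proof (intro bind_pmf_cong refl)
      fix q assume q: "q \<in> set_pmf \<gamma>"
      then have "snd q \<in> set_pmf \<nu>" by (auto simp: \<nu>(1))
      then have "map_pmf (\<lambda>p. (snd q, snd p)) (C (snd q)) = map_pmf (\<lambda>p. p) (C (snd q))"
        using fst by (intro map_pmf_cong) (auto simp: prod_eq_iff)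
      then show "map_pmf (\<lambda>(x, y, z). (y, z)) (case q of (x, y) \<Rightarrow> map_pmf (\<lambda>p. (x, y, snd p)) (C y)) = C (snd q)"
        by (auto simp: case_prod_unfold pmf.map_comp comp_def)
    qed
    also have "\<dots> = bind_pmf \<nu> C" by (simp add: \<nu>(1) bind_map_pmf)
    also have "\<dots> = \<gamma>'"
      unfolding C_def
    proof (rule bind_cond_pmf_cancel)
      show "set_pmf \<nu> \<inter> {x. fst p = x} \<noteq> {}" if "p \<in> set_pmf \<gamma>'" for p
        using that by (auto simp: \<nu>(2))
      show "measure_pmf.prob \<gamma>' {y. fst y = x} = measure_pmf.prob \<nu> {x. fst y = x}" if "fst y = x" for x y
        using that by (simp add: \<nu>(2) vimage_def eq_commute)
    qed (rule ne)
    finally show ?thesis .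
  qed
  ultimately show ?thesis using that by (simp add: bind_return_pmf')
qed

text \<open>Nearly optimal couplings are glued, and the outer two coordinates are kept. Finite
  supports make all costs integrable.\<close>

lemma wasserstein1_triangle:
  fixes \<mu> \<nu> \<rho> :: "'a::metric_space pmf"
  assumes fin: "finite (set_pmf \<mu>)" "finite (set_pmf \<nu>)" "finite (set_pmf \<rho>)"
  shows "wasserstein1 \<mu> \<rho> \<le> wasserstein1 \<mu> \<nu> + wasserstein1 \<nu> \<rho>"
proof (rule field_le_epsilon)
  fix e :: real assume "0 < e"
  then obtain \<gamma> \<gamma>' where \<gamma>: "coupling \<mu> \<nu> \<gamma>" "cost \<gamma> < wasserstein1 \<mu> \<nu> + e / 2"
    and \<gamma>': "coupling \<nu> \<rho> \<gamma>'" "cost \<gamma>' < wasserstein1 \<nu> \<rho> + e / 2"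
    using wasserstein1_lessE [of \<mu> \<nu> "wasserstein1 \<mu> \<nu> + e / 2"]
      wasserstein1_lessE [of \<nu> \<rho> "wasserstein1 \<nu> \<rho> + e / 2"] by (metis half_gt_zero less_add_same_cancel1)
  obtain \<eta> where \<eta>: "map_pmf (\<lambda>(x, y, z). (x, y)) \<eta> = \<gamma>" "map_pmf (\<lambda>(x, y, z). (y, z)) \<eta> = \<gamma>'"
    using coupling_glue [OF \<gamma>(1) \<gamma>'(1)] .
  have "finite (set_pmf \<eta>)"
  proof (rule finite_subset)
    show "set_pmf \<eta> \<subseteq> set_pmf \<mu> \<times> set_pmf \<nu> \<times> set_pmf \<rho>"
    proof
      fix t assume t: "t \<in> set_pmf \<eta>"
      obtain x y z where xyz: "t = (x, y, z)" by (cases t)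
      then have "(x, y) \<in> set_pmf \<gamma>" "(y, z) \<in> set_pmf \<gamma>'"
        using t by (force simp flip: \<eta>)+
      then show "t \<in> set_pmf \<mu> \<times> set_pmf \<nu> \<times> set_pmf \<rho>"
        using coupling_support [OF \<gamma>(1)] coupling_support [OF \<gamma>'(1)] xyz by auto
    qed
  qed (use fin in auto)
  then have int: "integrable (measure_pmf \<eta>) f" for f :: "'a \<times> 'a \<times> 'a \<Rightarrow> real"
    by (rule integrable_measure_pmf_finite)
  let ?\<theta> = "map_pmf (\<lambda>(x, y, z). (x, z)) \<eta>"
  have "map_pmf fst ?\<theta> = map_pmf fst \<gamma>" "map_pmf snd ?\<theta> = map_pmf snd \<gamma>'"
    by (simp_all add: pmf.map_comp comp_def case_prod_unfold flip: \<eta>)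
  then have "coupling \<mu> \<rho> ?\<theta>"
    using \<gamma>(1) \<gamma>'(1) by (simp add: coupling_def)
  then have "wasserstein1 \<mu> \<rho> \<le> cost ?\<theta>" by (rule wasserstein1_le_cost)
  also have "cost ?\<theta> \<le> measure_pmf.expectation \<eta> (\<lambda>(x, y, z). dist x y + dist y z)"
    unfolding cost_def integral_map_pmf
    by (intro integral_mono int) (auto simp: case_prod_unfold dist_triangle)
  also have "\<dots> = cost \<gamma> + cost \<gamma>'"
    unfolding cost_def \<eta> [symmetric] integral_map_pmf
    by (subst Bochner_Integration.integral_add [symmetric, OF int int]) (simp add: case_prod_unfold)
  finally show "wasserstein1 \<mu> \<rho> \<le> wasserstein1 \<mu> \<nu> + wasserstein1 \<nu> \<rho> + e"
    using \<gamma>(2) \<gamma>'(2) by simp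
qed

text \<open>At distance at least \<open>\<eta>\<close> the oscillation 2 of \<open>G\<close> is at most \<open>2 / \<eta>\<close> times the distance.\<close>

lemma expectation_diff_le_cost:
  fixes \<mu> \<nu> :: "'a::metric_space pmf" and G :: "'a \<Rightarrow> real"
  assumes fin: "finite (set_pmf \<mu>)" "finite (set_pmf \<nu>)" and \<gamma>: "coupling \<mu> \<nu> \<gamma>"
    and G: "\<And>x. \<bar>G x\<bar> \<le> 1" and "0 < \<eta>" "0 \<le> e"
    and near: "\<And>x y. \<lbrakk>x \<in> set_pmf \<mu>; y \<in> set_pmf \<nu>; dist x y < \<eta>\<rbrakk> \<Longrightarrow> \<bar>G x - G y\<bar> \<le> e"
  shows "\<bar>measure_pmf.expectation \<mu> G - measure_pmf.expectation \<nu> G\<bar> \<le> e + 2 / \<eta> * cost \<gamma>"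
proof -
  have int: "integrable (measure_pmf \<gamma>) f" for f :: "'a \<times> 'a \<Rightarrow> real"
    by (intro integrable_measure_pmf_finite coupling_finite [OF \<gamma> fin])
  have "measure_pmf.expectation \<mu> G = measure_pmf.expectation \<gamma> (\<lambda>p. G (fst p))"
    "measure_pmf.expectation \<nu> G = measure_pmf.expectation \<gamma> (\<lambda>p. G (snd p))"
    using \<gamma> by (auto simp: coupling_def simp flip: integral_map_pmf)
  then have "\<bar>measure_pmf.expectation \<mu> G - measure_pmf.expectation \<nu> G\<bar> =
      \<bar>measure_pmf.expectation \<gamma> (\<lambda>p. G (fst p) - G (snd p))\<bar>"
    by (simp add: Bochner_Integration.integral_diff [OF int int])
  also have "\<dots> \<le> measure_pmf.expectation \<gamma> (\<lambda>p. \<bar>G (fst p) - G (snd p)\<bar>)"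
    by (rule integral_abs_bound)
  also have "\<dots> \<le> measure_pmf.expectation \<gamma> (\<lambda>p. e + 2 / \<eta> * dist (fst p) (snd p))"
  proof (intro integral_mono_AE int)
    have "\<bar>G (fst p) - G (snd p)\<bar> \<le> e + 2 / \<eta> * dist (fst p) (snd p)" if "p \<in> set_pmf \<gamma>" for p
    proof (cases "dist (fst p) (snd p) < \<eta>")
      case True
      moreover have "fst p \<in> set_pmf \<mu>" "snd p \<in> set_pmf \<nu>"
        using coupling_support [OF \<gamma>] that by auto
      ultimately have "\<bar>G (fst p) - G (snd p)\<bar> \<le> e" by (intro near)
      moreover have "0 \<le> 2 / \<eta> * dist (fst p) (snd p)" using \<open>0 < \<eta>\<close> by simp
      ultimately show ?thesis by linarith
    next
      case False
      then have "2 \<le> 2 / \<eta> * dist (fst p) (snd p)" using \<open>0 < \<eta>\<close> by (simp add: field_simps)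
      then show ?thesis using G [of "fst p"] G [of "snd p"] \<open>0 \<le> e\<close> by linarith
    qed
    then show "AE p in \<gamma>. \<bar>G (fst p) - G (snd p)\<bar> \<le> e + 2 / \<eta> * dist (fst p) (snd p)"
      by (simp add: AE_measure_pmf_iff)
  qed
  also have "\<dots> = e + 2 / \<eta> * cost \<gamma>"
    by (simp add: Bochner_Integration.integral_add [OF int int] cost_def case_prod_unfold)
  finally show ?thesis .
qed

text \<open>On finite supports the indicator of a point does not vary at small distances, so
  \<open>expectation_diff_le_cost\<close> with \<open>e = 0\<close> bounds the difference of the
  masses there by a multiple of the cost.\<close>

lemma wasserstein1_eq_0_imp_eq:
  fixes \<mu> \<nu> :: "'a::metric_space pmf"
  assumes fin: "finite (set_pmf \<mu>)" "finite (set_pmf \<nu>)" and W: "wasserstein1 \<mu> \<nu> = 0"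
  shows "\<mu> = \<nu>"
proof (rule pmf_eqI)
  fix a :: 'a
  let ?G = "indicat_real {a}"
  obtain \<eta> where \<eta>: "\<eta> > 0" "\<And>x. \<lbrakk>x \<in> set_pmf \<mu> \<union> set_pmf \<nu>; x \<noteq> a\<rbrakk> \<Longrightarrow> \<eta> \<le> dist a x"
    using finite_set_avoid [of "set_pmf \<mu> \<union> set_pmf \<nu>" a] fin by auto
  have near: "\<bar>?G x - ?G y\<bar> \<le> 0" if "x \<in> set_pmf \<mu>" "y \<in> set_pmf \<nu>" "dist x y < \<eta>" for x y
    using \<eta>(2) [of x] \<eta>(2) [of y] that
    by (cases "x = a"; cases "y = a") (auto simp: indicator_def dist_commute)
  have "\<bar>pmf \<mu> a - pmf \<nu> a\<bar> \<le> 0 + r" if r: "r > 0" for r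
  proof -
    obtain \<gamma> where \<gamma>: "coupling \<mu> \<nu> \<gamma>" "cost \<gamma> < r * \<eta> / 2"
      using wasserstein1_lessE [of \<mu> \<nu> "r * \<eta> / 2"] W \<eta>(1) r by auto
    have "\<bar>measure_pmf.expectation \<mu> ?G - measure_pmf.expectation \<nu> ?G\<bar> \<le> 0 + 2 / \<eta> * cost \<gamma>"
      by (rule expectation_diff_le_cost [OF fin \<gamma>(1)]) (use \<eta>(1) near in \<open>auto simp: indicator_def\<close>)
    also have "\<dots> \<le> r" using \<gamma>(2) \<eta>(1) by (simp add: field_simps)
    finally show ?thesis by (simp add: measure_pmf_single)
  qed
  then have "\<bar>pmf \<mu> a - pmf \<nu> a\<bar> \<le> 0" by (rule field_le_epsilon)
  then show "pmf \<mu> a = pmf \<nu> a" by simp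
qed

lemma wasserstein1_self: "wasserstein1 \<mu> \<mu> = 0"
proof -
  have "coupling \<mu> \<mu> (map_pmf (\<lambda>x. (x, x)) \<mu>)" by (simp add: coupling_def pmf.map_comp comp_def)
  from wasserstein1_le_cost [OF this] show ?thesis
    using wasserstein1_nonneg [of \<mu> \<mu>] by (simp add: cost_def)
qed

lemma Metric_space_VR_thickening:
  "Metric_space (VR_thickening \<delta> :: 'a::metric_space pmf set) wasserstein1"
proof
  show "wasserstein1 \<mu> \<nu> = 0 \<longleftrightarrow> \<mu> = \<nu>" if "\<mu> \<in> VR_thickening \<delta>" "\<nu> \<in> VR_thickening \<delta>" for \<mu> \<nu> :: "'a pmf"
    using wasserstein1_eq_0_imp_eq that by (auto simp: VR_thickening_def wasserstein1_self)
qed (auto simp: wasserstein1_nonneg wasserstein1_commute VR_thickening_def intro: wasserstein1_triangle)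

lemma topspace_VR_topology [simp]: "topspace (VR_topology \<delta>) = VR_thickening \<delta>"
  by (simp add: VR_topology_def Metric_space.topspace_mtopology [OF Metric_space_VR_thickening])

text \<open>The measure \<open>\<mu>\<close> at which continuity is tested has finite support, so
  continuity of \<open>G\<close> at these points gives one \<open>\<eta>\<close> for all of them,
  against arbitrary points of the other measure.\<close>

lemma continuous_map_VR_expectation:
  fixes G :: "'a::metric_space \<Rightarrow> real"
  assumes cont: "continuous_on UNIV G" and G: "\<And>x. \<bar>G x\<bar> \<le> 1"
  shows "continuous_map (VR_topology \<delta>) euclideanreal (\<lambda>\<mu>. measure_pmf.expectation \<mu> G)"
  unfolding VR_topology_def Metric_space.continuous_map_from_metric [OF Metric_space_VR_thickening]
proof (intro conjI ballI allI impI; (elim conjE)?)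
  fix \<mu> :: "'a pmf" and U :: "real set"
  assume \<mu>: "\<mu> \<in> VR_thickening \<delta>" and "openin euclideanreal U" "measure_pmf.expectation \<mu> G \<in> U"
  then obtain e where e: "e > 0" "ball (measure_pmf.expectation \<mu> G) e \<subseteq> U"
    by (auto simp: open_contains_ball)
  have fin: "finite (set_pmf \<mu>)" using \<mu> by (simp add: VR_thickening_def)
  have "\<exists>\<eta>>0. \<forall>y. dist x y < \<eta> \<longrightarrow> \<bar>G x - G y\<bar> \<le> e / 2" for x
  proof -
    obtain \<eta> where \<eta>: "\<eta> > 0" "\<And>y. dist y x < \<eta> \<Longrightarrow> dist (G y) (G x) < e / 2"
      using cont e(1) unfolding continuous_on_iff by (metis UNIV_I half_gt_zero)
    have "\<bar>G x - G y\<bar> \<le> e / 2" if "dist x y < \<eta>" for y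
      using \<eta>(2) [of y] that by (simp add: dist_commute dist_real_def abs_minus_commute)
    with \<eta>(1) show ?thesis by blast
  qed
  then obtain N where N: "\<And>x. N x > 0" "\<And>x y. dist x y < N x \<Longrightarrow> \<bar>G x - G y\<bar> \<le> e / 2" by metis
  define \<eta> where "\<eta> = Min (N ` set_pmf \<mu>)"
  have \<eta>: "\<eta> > 0" "\<And>x. x \<in> set_pmf \<mu> \<Longrightarrow> \<eta> \<le> N x"
    using fin N(1) by (auto simp: \<eta>_def set_pmf_not_empty)
  show "\<exists>r>0. \<forall>\<nu>. \<nu> \<in> VR_thickening \<delta> \<and> wasserstein1 \<mu> \<nu> < r \<longrightarrow> measure_pmf.expectation \<nu> G \<in> U"
  \<comment> \<open>The radius turns the term \<open>2 / \<eta> * cost \<gamma>\<close> into less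
    than \<open>e / 2\<close>; near pairs contribute the other half.\<close>
  proof (intro exI [of _ "e * \<eta> / 4"] conjI allI impI; (elim conjE)?)
    fix \<nu> assume \<nu>: "\<nu> \<in> VR_thickening \<delta>" and "wasserstein1 \<mu> \<nu> < e * \<eta> / 4"
    then obtain \<gamma> where \<gamma>: "coupling \<mu> \<nu> \<gamma>" "cost \<gamma> < e * \<eta> / 4" by (blast elim: wasserstein1_lessE)
    have near: "\<bar>G x - G y\<bar> \<le> e / 2" if "x \<in> set_pmf \<mu>" "dist x y < \<eta>" for x y
      using N(2) [of x y] \<eta>(2) [OF that(1)] that(2) by linarith
    have "\<bar>measure_pmf.expectation \<mu> G - measure_pmf.expectation \<nu> G\<bar> \<le> e / 2 + 2 / \<eta> * cost \<gamma>"
      by (rule expectation_diff_le_cost [OF fin _ \<gamma>(1) G]) (use \<nu> \<eta>(1) e(1) near in \<open>auto simp: VR_thickening_def\<close>)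
    also have "2 / \<eta> * cost \<gamma> < e / 2" using \<gamma>(2) \<eta>(1) by (simp add: field_simps)
    finally show "measure_pmf.expectation \<nu> G \<in> U" using e(2) by (auto simp: dist_real_def)
  qed (use e(1) \<eta>(1) in auto)
qed auto

section \<open>The odd map on the thickening\<close>

lemma function_space_of_dimE:
  assumes "function_space_of_dim V n"
  obtains b where "\<forall>i<n. b i \<in> V" "\<forall>f\<in>V. \<exists>c. \<forall>x. f x = (\<Sum>i<n. c i * b i x)"
proof -
  obtain B where B: "finite B" "card B = n" "funspace.span B = V"
    using assms by (auto simp: function_space_of_dim_def)
  obtain b where b: "bij_betw b {..<n} B"
    using ex_bij_betw_nat_finite [OF B(1)] B(2) by (auto simp: atLeast0LessThan)
  have "b i \<in> V" if "i < n" for i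
    using funspace.span_superset [of B] B(3) bij_betwE [OF b] that by auto
  moreover have "\<exists>c. \<forall>x. f x = (\<Sum>i<n. c i * b i x)" if f: "f \<in> V" for f
  proof -
    obtain u where u: "f = (\<Sum>v\<in>B. (\<lambda>x. u v * v x))"
      using f B(3) funspace.span_finite [OF B(1)] by auto
    have "f x = (\<Sum>i<n. u (b i) * b i x)" for x
    proof -
      have "(\<Sum>v\<in>S. (\<lambda>x. u v * v x)) x = (\<Sum>v\<in>S. u v * v x)" for S
        by (induction S rule: infinite_finite_induct) auto
      then have "f x = (\<Sum>v\<in>B. u v * v x)" by (simp add: u)
      also have "\<dots> = (\<Sum>i<n. u (b i) * b i x)"
        by (rule sum.reindex_bij_betw [OF b, symmetric])
      finally show ?thesis .
    qed
    then show ?thesis by (intro exI [of _ "\<lambda>i. u (b i)"]) simp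
  qed
  ultimately show ?thesis using that by blast
qed

lemma odd_map_VR_nsphere:
  fixes neg :: "'a::metric_space \<Rightarrow> 'a" and b :: "nat \<Rightarrow> 'a \<Rightarrow> real"
  assumes cont: "\<And>i. i < n \<Longrightarrow> continuous_on UNIV (b i)"
    and odd: "\<And>i x. i < n \<Longrightarrow> b i (neg x) = - b i x"
    and pos: "\<And>A. \<lbrakk>finite A; diameter A \<le> \<delta>\<rbrakk> \<Longrightarrow> \<exists>c. \<forall>x\<in>A. (\<Sum>i<n. c i * b i x) > 0"
    and "\<delta> > 0" "n > 0"
  shows "\<exists>g. odd_map (VR_topology \<delta>) (map_pmf neg) (nsphere (n - 1)) antipode g"
proof -
  \<comment> \<open>The \<open>b i\<close> may be unbounded on bounded sets, and then integration against them is not continuous for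
    \<open>wasserstein1\<close>; dividing by the even function \<open>N\<close> bounds them and keeps their signs.\<close>
  define N where "N x = sqrt (\<Sum>i<n. (b i x)\<^sup>2)" for x
  define G where "G i x = b i x / N x" for i x
  define \<Phi> where "\<Phi> i \<mu> = measure_pmf.expectation \<mu> (G i)" for i \<mu>
  define R where "R \<mu> = sqrt (\<Sum>i<n. (\<Phi> i \<mu>)\<^sup>2)" for \<mu>
  define g where "g \<mu> = (\<lambda>i. if i < n then \<Phi> i \<mu> / R \<mu> else 0)" for \<mu>
  have N_pos: "N x > 0" for x
  proof -
    \<comment> \<open>A single point has diameter 0, so some combination, and hence some
      \<open>b i\<close>, is nonzero there.\<close>
    obtain c where "(\<Sum>i<n. c i * b i x) > 0" using pos [of "{x}"] \<open>\<delta> > 0\<close> by auto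
    then have "(\<Sum>i<n. c i * b i x) \<noteq> 0" by simp
    then obtain i where "i \<in> {..<n}" "c i * b i x \<noteq> 0"
      by (rule sum.not_neutral_contains_not_neutral)
    then have "0 < (\<Sum>i<n. (b i x)\<^sup>2)" by (intro sum_pos2 [of _ i]) auto
    then show ?thesis by (simp add: N_def)
  qed
  then have N_nz: "N x \<noteq> 0" for x by (metis less_irrefl)
  have G_bound: "\<bar>G i x\<bar> \<le> 1" if "i < n" for i x
  proof -
    have "(b i x)\<^sup>2 \<le> (\<Sum>i<n. (b i x)\<^sup>2)" using that by (intro member_le_sum) auto
    then have "\<bar>b i x\<bar> \<le> N x" unfolding N_def by (rule real_le_rsqrt [of "\<bar>b i x\<bar>", simplified])
    then show ?thesis using N_pos [of x] by (simp add: G_def abs_divide)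
  qed
  have G_cont: "continuous_on UNIV (G i)" if "i < n" for i
    unfolding G_def N_def
    by (intro continuous_intros cont that) (use N_nz in \<open>auto simp: N_def\<close>)
  have \<Phi>_cont: "continuous_map (VR_topology \<delta>) euclideanreal (\<Phi> i)" if "i < n" for i
    using continuous_map_VR_expectation [OF G_cont G_bound] that by (simp add: \<Phi>_def [abs_def])
  have "G i (neg x) = - G i x" if "i < n" for i x
    using odd that by (simp add: G_def N_def)
  then have \<Phi>_odd: "\<Phi> i (map_pmf neg \<mu>) = - \<Phi> i \<mu>" if "i < n" for i \<mu>
    using that by (simp add: \<Phi>_def)
  have R_pos: "R \<mu> > 0" if \<mu>: "\<mu> \<in> VR_thickening \<delta>" for \<mu>
  proof -
    have fin: "finite (set_pmf \<mu>)" using \<mu> by (simp add: VR_thickening_def)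
    obtain c where c: "\<And>x. x \<in> set_pmf \<mu> \<Longrightarrow> (\<Sum>i<n. c i * b i x) > 0"
      using pos [OF fin] \<mu> by (auto simp: VR_thickening_def)
    \<comment> \<open>The linear form with coefficients \<open>c\<close> takes at the vector of the
      \<open>\<Phi> i \<mu>\<close> the integral of a function that is positive on the
      support.\<close>
    have "(\<Sum>i<n. c i * \<Phi> i \<mu>) = measure_pmf.expectation \<mu> (\<lambda>x. \<Sum>i<n. c i * G i x)"
      unfolding \<Phi>_def
      by (simp add: Bochner_Integration.integral_sum integrable_measure_pmf_finite [OF fin])
    also have "\<dots> = (\<Sum>x\<in>set_pmf \<mu>. (\<Sum>i<n. c i * G i x) * pmf \<mu> x)"
      by (rule integral_measure_pmf_real [OF fin])
    also have "\<dots> > 0"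
    proof (rule sum_pos [OF fin set_pmf_not_empty])
      fix x assume x: "x \<in> set_pmf \<mu>"
      have "(\<Sum>i<n. c i * G i x) = (\<Sum>i<n. c i * b i x) / N x"
        by (simp add: G_def sum_divide_distrib)
      then show "(\<Sum>i<n. c i * G i x) * pmf \<mu> x > 0"
        using c [OF x] N_pos [of x] x by (simp add: pmf_positive)
    qed
    finally have "(\<Sum>i<n. c i * \<Phi> i \<mu>) \<noteq> 0" by simp
    then obtain i where "i \<in> {..<n}" "c i * \<Phi> i \<mu> \<noteq> 0"
      by (rule sum.not_neutral_contains_not_neutral)
    then have "0 < (\<Sum>i<n. (\<Phi> i \<mu>)\<^sup>2)" by (intro sum_pos2 [of _ i]) auto
    then show ?thesis by (simp add: R_def)
  qed
  then have R_nz: "R \<mu> \<noteq> 0" if "\<mu> \<in> VR_thickening \<delta>" for \<mu>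
    using that by (metis less_irrefl)
  have "continuous_map (VR_topology \<delta>) (nsphere (n - 1)) g"
    unfolding nsphere continuous_map_in_subtopology continuous_map_componentwise_UNIV
  proof (intro conjI allI)
    fix i
    have "continuous_map (VR_topology \<delta>) euclideanreal (\<lambda>\<mu>. \<Phi> i \<mu> / R \<mu>)" if "i < n"
      unfolding R_def
      by (intro continuous_intros \<Phi>_cont that) (use R_nz in \<open>auto simp: R_def\<close>)
    then show "continuous_map (VR_topology \<delta>) euclideanreal (\<lambda>\<mu>. g \<mu> i)"
      by (cases "i < n") (simp_all add: g_def)
  next
    have "(\<Sum>i\<le>n - 1. (g \<mu> i)\<^sup>2) = 1" if "\<mu> \<in> VR_thickening \<delta>" for \<mu>
    proof -
      \<comment> \<open>The sphere of dimension \<open>n - 1\<close> has the coordinates up to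
        \<open>n - 1\<close>; these are the \<open>n\<close> indices below \<open>n\<close> because
        \<open>n > 0\<close>.\<close>
      have "(\<Sum>i\<le>n - 1. (g \<mu> i)\<^sup>2) = (\<Sum>i<n. (\<Phi> i \<mu> / R \<mu>)\<^sup>2)"
        using \<open>n > 0\<close> by (intro sum.cong) (auto simp: g_def)
      also have "\<dots> = (\<Sum>i<n. (\<Phi> i \<mu>)\<^sup>2) / (R \<mu>)\<^sup>2"
        by (simp add: power_divide sum_divide_distrib)
      also have "\<dots> = 1"
        using R_nz [OF that] by (simp add: R_def sum_nonneg)
      finally show ?thesis .
    qed
    then show "g \<in> topspace (VR_topology \<delta>) \<rightarrow> {x. (\<Sum>i\<le>n - 1. (x i)\<^sup>2) = 1 \<and> (\<forall>i>n - 1. x i = 0)}"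
      by (auto simp: g_def)
  qed
  moreover have "g (map_pmf neg \<mu>) = antipode (g \<mu>)" for \<mu>
    by (auto simp: g_def antipode_def R_def \<Phi>_odd)
  ultimately show ?thesis by (auto simp: odd_map_def)
qed

theorem theorem4:
  fixes neg :: "'a::metric_space \<Rightarrow> 'a"
    and \<delta> :: real
    and V :: "('a \<Rightarrow> real) set"
    and n :: nat
  assumes "free_involution neg"
    and "\<delta> > 0"
    and "function_space_of_dim V n"
    and "\<And>f. f \<in> V \<Longrightarrow> continuous_on UNIV f \<and> (\<forall>x. f (neg x) = - f x)"
    and "\<And>A :: 'a set. bounded A \<Longrightarrow> diameter A \<le> \<delta> \<Longrightarrow> \<exists>f\<in>V. \<forall>x\<in>A. f x > 0"
  shows "(\<exists>g. odd_map (VR_topology \<delta>) (map_pmf neg) (nsphere (n - 1)) antipode g) \<and>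
         cohomological_index (VR_topology \<delta> :: 'a pmf topology) (map_pmf neg) \<le> ereal (real n - 1)"
proof -
  obtain b where b: "\<forall>i<n. b i \<in> V" and
    span: "\<forall>f\<in>V. \<exists>c. \<forall>x. f x = (\<Sum>i<n. c i * b i x)"
    using function_space_of_dimE [OF assms(3)] .
  have pos: "\<exists>c. \<forall>x\<in>A. (\<Sum>i<n. c i * b i x) > 0" if A: "finite A" "diameter A \<le> \<delta>" for A
  proof -
    obtain f where f: "f \<in> V" "\<forall>x\<in>A. f x > 0" using assms(5) finite_imp_bounded A by blast
    obtain c where "\<forall>x. f x = (\<Sum>i<n. c i * b i x)" using span f(1) by blast
    then show ?thesis using f(2) by (intro exI [of _ c]) metis
  qed
  \<comment> \<open>Types are inhabited, so there is a point, at which an empty sum would have to be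
    positive. This makes the truncated \<open>n - 1\<close> the true difference in both
    claims.\<close>
  have "n > 0"
    using pos [of "{undefined}"] \<open>\<delta> > 0\<close> by (auto intro: gr0I)
  have "\<exists>g. odd_map (VR_topology \<delta>) (map_pmf neg) (nsphere (n - 1)) antipode g"
    by (rule odd_map_VR_nsphere [OF _ _ pos \<open>\<delta> > 0\<close> \<open>n > 0\<close>]) (use assms(4) b in auto)
  moreover from this have "cohomological_index (VR_topology \<delta> :: 'a pmf topology) (map_pmf neg) \<le> ereal (real (n - 1))"
    by (blast intro: cohomological_index_le)
  ultimately show ?thesis using \<open>n > 0\<close> by (simp add: of_nat_diff)
qed

end
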